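(* Let $p,q\ge1$, let $\Sigma\subset\mathbb{Z}^N$ be simply connected, and let $(f,\eta):\Sigma\to\mathcal{Z}$ be an applicable Legendre map with stereoprojection $L:\Sigma\to\mathcal{Z}_{\mathfrak{q}}$. Let $\check{x}^\eta:\Sigma\to\mathbb{R}^{p,q}$ solve $\mathrm{d}\check{x}^\eta=\pi(\eta\mathfrak{q})$ and let $\check{L}:\Sigma\to\mathcal{Z}_{\mathfrak{q}}$ consist of the lines through $\check{x}^\eta$ parallel to $L$: $\check L_i$ is the affine line through $\check x^\eta_i$ parallel to $L_i$. Then $\check{L}$ is also the stereoprojection of an applicable Legendre map.
   Context: Domain: an edge $ij$ of $\Sigma\subset\mathbb{Z}^N$ is a pair of points of $\Sigma$ differing by a standard unit vector; a quadrilateral is an elementary square with all four vertices $i,j,k,\ell$ (in cyclic order) in $\Sigma$. $\Sigma$ is simply connected if any two points are joined by an edge-path in $\Sigma$ and any two edge-paths in $\Sigma$ with the same end-points are related by finitely many moves: (a) replace $i$ by $(iji)$ or conversely, $ij$ an edge; (b) replace $(k\ell i)$ by $(kji)$ on a quadrilateral. A vector-valued $1$-form $\alpha$ assigns $\alpha_{ji}=-\alpha_{ij}$ to each oriented edge from $i$ to $j$; it is closed if $\alpha_{i\ell}+\alpha_{\ell k}+\alpha_{kj}+\alpha_{ji}=0$ on every quadrilateral. $\mathrm{d}x_{ji}=x_j-x_i$. $\mathbb{R}^{p+1,q+1}$ has a non-degenerate symmetric bilinear form $(\cdot,\cdot)$ of signature $(p+1,q+1)$, with light cone $\mathcal{L}$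 and quadric $\mathcal{Q}=\mathbb{P}(\mathcal{L})$. $\Lambda^2\mathbb{R}^{p+1,q+1}$ acts by $(a\wedge b)(z)=(a,z)b-(b,z)a$. $\mathcal{Z}$ is the set of totally null $2$-planes in $\mathbb{R}^{p+1,q+1}$ (projective lines in $\mathcal{Q}$). A Legendre map is $f:\Sigma\to\mathcal{Z}$ with $f_i\cap f_j\neq\{0\}$ on each edge. Regular: (i) on each edge $f_{ij}:=f_i+f_j$ is $3$-dimensional, so $s_{ij}:=f_i\cap f_j$ is $1$-dimensional; (ii) on each quadrilateral $s_{ij}\wedge s_{jk}\wedge s_{k\ell}\wedge s_{\ell i}\ne\{0\}$. A regular Legendre map is applicable, written $(f,\eta)$, if there is a closed $\Lambda^2\mathbb{R}^{p+1,q+1}$-valued $1$-form $\eta$ with $\eta_{ij}\in\Lambda^2f_{ij}$ and $\eta_{ij}\wedge s_{ij}\neq\{0\}$ on each edge. Regularity is a standing assumption imposed on all Legendre maps under consideration (also on the one with stereoprojection $\check L$). Stereoprojection: fix $\mathfrak{o},\mathfrak{q}\in\mathcal{L}$ with $(\mathfrak{o},\mathfrak{q})=-1$, let $\mathbb{R}^{p,q}=\langle\mathfrak{o},\mathfrak{q}\rangle^\perp$ and $\pi:\mathbb{R}^{p+1,q+1}\to\mathbb{R}^{p,q}$ orthogonal projection. Put $\phi(x)=\mathfrak{o}+x+\tfrac12(x,x)\mathfrak{q}$. Let $\mathcal{Z}_{\mathfrak{q}}$ be the set of affine null lines in $\mathbb{R}^{p,q}$; it is identified with the set of $2$-planes in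 $\mathcal{Z}$ not contained in $\mathfrak{q}^\perp$ by sending an affine null line $\{x+rv: r\in\mathbb{R}\}$ ($v$ null, non-zero) to the null $2$-plane $\langle\phi(x),\,v+(x,v)\mathfrak{q}\rangle$ spanned by the $\phi$ of its points. The stereoprojection of $f$ (with no $f_i\subset\mathfrak{q}^\perp$) is the corresponding $L:\Sigma\to\mathcal{Z}_{\mathfrak{q}}$. *)

theory Defs
  imports "HOL-Analysis.Analysis"
begin

section \<open>Domains in the integer lattice\<close>

definition lattice_edge :: "(int^'m) set \<Rightarrow> int^'m \<Rightarrow> int^'m \<Rightarrow> bool" where
  "lattice_edge S i j \<longleftrightarrow> i \<in> S \<and> j \<in> S \<and> (\<exists>a. j = i + axis a 1 \<or> i = j + axis a 1)"

text \<open>The signs allow every choice of starting vertex and of sense of rotation around the square.\<close>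

definition quadrilateral :: "(int^'m) set \<Rightarrow> int^'m \<Rightarrow> int^'m \<Rightarrow> int^'m \<Rightarrow> int^'m \<Rightarrow> bool" where
  "quadrilateral S i j k l \<longleftrightarrow> i \<in> S \<and> j \<in> S \<and> k \<in> S \<and> l \<in> S \<and>
     (\<exists>a b s t. a \<noteq> b \<and> s \<in> {1, -1} \<and> t \<in> {1, -1} \<and>
        j = i + axis a s \<and> k = i + axis a s + axis b t \<and> l = i + axis b t)"

definition edge_path :: "(int^'m) set \<Rightarrow> (int^'m) list \<Rightarrow> bool" where
  "edge_path S w \<longleftrightarrow> w \<noteq> [] \<and> set w \<subseteq> S \<and> successively (lattice_edge S) w"

inductive path_move :: "(int^'m) set \<Rightarrow> (int^'m) list \<Rightarrow> (int^'m) list \<Rightarrow> bool" for S where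
  backtrack: "lattice_edge S i j \<Longrightarrow> path_move S (u @ [i] @ w) (u @ [i, j, i] @ w)"
| flip: "quadrilateral S i j k l \<Longrightarrow> path_move S (u @ [k, l, i] @ w) (u @ [k, j, i] @ w)"

definition lattice_simply_connected :: "(int^'m) set \<Rightarrow> bool" where
  "lattice_simply_connected S \<longleftrightarrow>
     (\<forall>i\<in>S. \<forall>j\<in>S. \<exists>w. edge_path S w \<and> hd w = i \<and> last w = j) \<and>
     (\<forall>w w'. edge_path S w \<and> edge_path S w' \<and> hd w = hd w' \<and> last w = last w'
        \<longrightarrow> equivclp (path_move S) w w')"

section \<open>Discrete one-forms\<close>

text \<open>A one-form is a function of two arguments: \<open>\<alpha> j i\<close> is the value on the edge
  directed from \<open>i\<close> to \<open>j\<close>.\<close>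

definition one_form :: "(int^'m) set \<Rightarrow> (int^'m \<Rightarrow> int^'m \<Rightarrow> 'v::real_vector) \<Rightarrow> bool" where
  "one_form S \<alpha> \<longleftrightarrow> (\<forall>i j. lattice_edge S i j \<longrightarrow> \<alpha> j i = - \<alpha> i j)"

definition closed_form :: "(int^'m) set \<Rightarrow> (int^'m \<Rightarrow> int^'m \<Rightarrow> 'v::real_vector) \<Rightarrow> bool" where
  "closed_form S \<alpha> \<longleftrightarrow>
     (\<forall>i j k l. quadrilateral S i j k l \<longrightarrow> \<alpha> i l + \<alpha> l k + \<alpha> k j + \<alpha> j i = 0)"

definition ddiff :: "(int^'m \<Rightarrow> 'v::real_vector) \<Rightarrow> int^'m \<Rightarrow> int^'m \<Rightarrow> 'v" where
  "ddiff x j i = x j - x i"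

section \<open>Exterior powers\<close>

text \<open>Exterior powers of \<open>V = real^'n\<close> are realised as antisymmetric tensors inside the tensor
  powers \<open>real^'n^'n\<close>, \<open>real^'n^'n^'n\<close>, ...; a product \<open>a\<^sub>1 \<and> \<dots> \<and> a\<^sub>k\<close> has as components
  the \<open>k \<times> k\<close> minors of the components of its factors.  \<open>wedge3\<close> and \<open>wedge4\<close> are
  right exterior multiplication of a bivector, respectively a trivector, by a vector.\<close>

definition wedge2 :: "real^'n \<Rightarrow> real^'n \<Rightarrow> real^'n^'n" where
  "wedge2 a b = (\<chi> i j. a $ i * b $ j - a $ j * b $ i)"

definition wedge3 :: "real^'n^'n \<Rightarrow> real^'n \<Rightarrow> real^'n^'n^'n" where
  "wedge3 \<omega> c = (\<chi> i j k. \<omega> $ i $ j * c $ k - \<omega> $ i $ k * c $ j + \<omega> $ j $ k * c $ i)"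

definition wedge4 :: "real^'n^'n^'n \<Rightarrow> real^'n \<Rightarrow> real^'n^'n^'n^'n" where
  "wedge4 \<tau> d = (\<chi> i j k l. \<tau> $ i $ j $ k * d $ l - \<tau> $ i $ j $ l * d $ k
     + \<tau> $ i $ k $ l * d $ j - \<tau> $ j $ k $ l * d $ i)"

lemma wedge2_swap: "wedge2 b a = - wedge2 a b"
  by (simp add: wedge2_def vec_eq_iff)

lemma wedge3_swap: "wedge3 (wedge2 a c) b = - wedge3 (wedge2 a b) c"
  by (simp add: wedge2_def wedge3_def vec_eq_iff algebra_simps)

lemma wedge4_swap:
  "wedge4 (wedge3 \<omega> d) c = - wedge4 (wedge3 \<omega> c) d"
  by (simp add: wedge3_def wedge4_def vec_eq_iff algebra_simps)

definition ext_square :: "(real^'n) set \<Rightarrow> (real^'n^'n) set" where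
  "ext_square W = span {wedge2 a b | a b. a \<in> W \<and> b \<in> W}"

definition biv_wedge_space :: "real^'n^'n \<Rightarrow> (real^'n) set \<Rightarrow> (real^'n^'n^'n) set" where
  "biv_wedge_space \<omega> W = span {wedge3 \<omega> c | c. c \<in> W}"

definition wedge_spaces ::
  "(real^'n) set \<Rightarrow> (real^'n) set \<Rightarrow> (real^'n) set \<Rightarrow> (real^'n) set \<Rightarrow> (real^'n^'n^'n^'n) set" where
  "wedge_spaces W1 W2 W3 W4 = span {wedge4 (wedge3 (wedge2 a b) c) d | a b c d.
     a \<in> W1 \<and> b \<in> W2 \<and> c \<in> W3 \<and> d \<in> W4}"

section \<open>Pseudo-Euclidean spaces\<close>

definition has_signature :: "(real^'n \<Rightarrow> real^'n \<Rightarrow> real) \<Rightarrow> nat \<Rightarrow> nat \<Rightarrow> bool" where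
  "has_signature B r s \<longleftrightarrow> bilinear B \<and> (\<forall>x y. B x y = B y x) \<and>
     (\<exists>P M. P \<inter> M = {} \<and> independent (P \<union> M) \<and> span (P \<union> M) = UNIV \<and>
        card P = r \<and> card M = s \<and>
        (\<forall>u\<in>P \<union> M. \<forall>v\<in>P \<union> M. u \<noteq> v \<longrightarrow> B u v = 0) \<and>
        (\<forall>u\<in>P. B u u = 1) \<and> (\<forall>u\<in>M. B u u = -1))"

definition light_cone :: "(real^'n \<Rightarrow> real^'n \<Rightarrow> real) \<Rightarrow> (real^'n) set" where
  "light_cone B = {z. B z z = 0}"

definition null_planes :: "(real^'n \<Rightarrow> real^'n \<Rightarrow> real) \<Rightarrow> (real^'n) set set" where
  "null_planes B = {W. subspace W \<and> dim W = 2 \<and> (\<forall>a\<in>W. \<forall>b\<in>W. B a b = 0)}"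

text \<open>The action of a bivector is the linear extension of
  \<open>(a \<and> b) z = (a, z) b - (b, z) a\<close>: contract the first tensor slot with \<open>z\<close>.\<close>

definition biv_act :: "(real^'n \<Rightarrow> real^'n \<Rightarrow> real) \<Rightarrow> real^'n^'n \<Rightarrow> real^'n \<Rightarrow> real^'n" where
  "biv_act B \<omega> z = (\<Sum>i\<in>UNIV. B (axis i 1) z *\<^sub>R (\<omega> $ i))"

lemma biv_act_wedge2:
  assumes "bilinear B"
  shows "biv_act B (wedge2 a b) z = B a z *\<^sub>R b - B b z *\<^sub>R a"
proof -
  have lin: "linear (\<lambda>x. B x z)" using assms by (simp add: bilinear_def)
  have exp: "B x z = (\<Sum>i\<in>UNIV. x $ i * B (axis i 1) z)" for x
  proof -
    have "B x z = B (\<Sum>i\<in>UNIV. x $ i *\<^sub>R axis i 1) z"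
      using basis_expansion[of x] by (simp add: scalar_mult_eq_scaleR)
    then show ?thesis by (simp add: linear_sum[OF lin] linear_scale[OF lin])
  qed
  show ?thesis
    by (simp add: biv_act_def wedge2_def vec_eq_iff exp[of a] exp[of b]
        sum_distrib_left sum_distrib_right sum_subtractf algebra_simps)
qed

section \<open>Legendre maps\<close>

definition sum_space :: "(real^'n) set \<Rightarrow> (real^'n) set \<Rightarrow> (real^'n) set" where
  "sum_space U W = {a + b | a b. a \<in> U \<and> b \<in> W}"

definition legendre_map ::
  "(real^'n \<Rightarrow> real^'n \<Rightarrow> real) \<Rightarrow> (int^'m) set \<Rightarrow> (int^'m \<Rightarrow> (real^'n) set) \<Rightarrow> bool" where
  "legendre_map B S f \<longleftrightarrow> (\<forall>i\<in>S. f i \<in> null_planes B) \<and>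
     (\<forall>i j. lattice_edge S i j \<longrightarrow> f i \<inter> f j \<noteq> {0})"

definition regular_map :: "(int^'m) set \<Rightarrow> (int^'m \<Rightarrow> (real^'n) set) \<Rightarrow> bool" where
  "regular_map S f \<longleftrightarrow>
     (\<forall>i j. lattice_edge S i j \<longrightarrow> dim (sum_space (f i) (f j)) = 3) \<and>
     (\<forall>i j k l. quadrilateral S i j k l \<longrightarrow>
        wedge_spaces (f i \<inter> f j) (f j \<inter> f k) (f k \<inter> f l) (f l \<inter> f i) \<noteq> {0})"

definition applicable_with ::
  "(real^'n \<Rightarrow> real^'n \<Rightarrow> real) \<Rightarrow> (int^'m) set \<Rightarrow> (int^'m \<Rightarrow> (real^'n) set)
     \<Rightarrow> (int^'m \<Rightarrow> int^'m \<Rightarrow> real^'n^'n) \<Rightarrow> bool" where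
  "applicable_with B S f \<eta> \<longleftrightarrow> legendre_map B S f \<and> regular_map S f \<and>
     one_form S \<eta> \<and> closed_form S \<eta> \<and>
     (\<forall>i j. lattice_edge S i j \<longrightarrow>
        \<eta> i j \<in> ext_square (sum_space (f i) (f j)) \<and>
        biv_wedge_space (\<eta> i j) (f i \<inter> f j) \<noteq> {0})"

definition applicable ::
  "(real^'n \<Rightarrow> real^'n \<Rightarrow> real) \<Rightarrow> (int^'m) set \<Rightarrow> (int^'m \<Rightarrow> (real^'n) set) \<Rightarrow> bool" where
  "applicable B S f \<longleftrightarrow> (\<exists>\<eta>. applicable_with B S f \<eta>)"

section \<open>Stereoprojection\<close>

text \<open>\<open>affine_part B \<oo> \<qq>\<close> is the copy \<open>\<langle>\<oo>, \<qq>\<rangle>\<^sup>\<bottom>\<close> of the space of signature \<open>(p, q)\<close>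
  inside the ambient space.\<close>

definition affine_part :: "(real^'n \<Rightarrow> real^'n \<Rightarrow> real) \<Rightarrow> real^'n \<Rightarrow> real^'n \<Rightarrow> (real^'n) set" where
  "affine_part B \<oo> \<qq> = {y. \<forall>u\<in>span {\<oo>, \<qq>}. B u y = 0}"

definition affine_proj :: "(real^'n \<Rightarrow> real^'n \<Rightarrow> real) \<Rightarrow> real^'n \<Rightarrow> real^'n \<Rightarrow> real^'n \<Rightarrow> real^'n" where
  "affine_proj B \<oo> \<qq> z = (THE y. y \<in> affine_part B \<oo> \<qq> \<and> z - y \<in> span {\<oo>, \<qq>})"

lemma affine_part_iff:
  assumes "bilinear B"
  shows "y \<in> affine_part B \<oo> \<qq> \<longleftrightarrow> B \<oo> y = 0 \<and> B \<qq> y = 0"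
proof -
  have lin: "linear (\<lambda>x. B x y)" using assms by (simp add: bilinear_def)
  have "B u y = 0" if "B \<oo> y = 0" "B \<qq> y = 0" "u \<in> span {\<oo>, \<qq>}" for u
    using linear_eq_0_on_span[OF lin, of "{\<oo>, \<qq>}" u] that by blast
  then show ?thesis by (auto simp: affine_part_def span_base)
qed

lemma affine_proj_eq:
  assumes B: "bilinear B" "\<And>x y. B x y = B y x"
    and n: "\<oo> \<in> light_cone B" "\<qq> \<in> light_cone B" "B \<oo> \<qq> = -1"
  shows "affine_proj B \<oo> \<qq> z = z + B z \<qq> *\<^sub>R \<oo> + B z \<oo> *\<^sub>R \<qq>"
  unfolding affine_proj_def
proof (rule the_equality)
  have qo: "B \<qq> \<oo> = -1" using n B(2) by metis
  have "(- B z \<qq>) *\<^sub>R \<oo> + (- B z \<oo>) *\<^sub>R \<qq> \<in> span {\<oo>, \<qq>}"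
    by (intro span_add span_scale span_base) auto
  then have s: "z - (z + B z \<qq> *\<^sub>R \<oo> + B z \<oo> *\<^sub>R \<qq>) \<in> span {\<oo>, \<qq>}"
    by (simp add: algebra_simps)
  show "z + B z \<qq> *\<^sub>R \<oo> + B z \<oo> *\<^sub>R \<qq> \<in> affine_part B \<oo> \<qq> \<and>
        z - (z + B z \<qq> *\<^sub>R \<oo> + B z \<oo> *\<^sub>R \<qq>) \<in> span {\<oo>, \<qq>}"
    using s n qo B(2)[of z] by (simp add: affine_part_iff[OF B(1)] light_cone_def
        bilinear_radd[OF B(1)] bilinear_rmul[OF B(1)])
next
  fix y assume y: "y \<in> affine_part B \<oo> \<qq> \<and> z - y \<in> span {\<oo>, \<qq>}"
  have qo: "B \<qq> \<oo> = -1" using n B(2) by metis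
  obtain a b where "z - y = a *\<^sub>R \<oo> + b *\<^sub>R \<qq>"
    using y by (auto simp: span_insert span_singleton algebra_simps)
  then have z: "z = y + a *\<^sub>R \<oo> + b *\<^sub>R \<qq>" by (simp add: algebra_simps)
  have "B y \<oo> = 0" "B y \<qq> = 0" using y B(2) by (auto simp: affine_part_iff[OF B(1)])
  then have "B z \<qq> = - a" "B z \<oo> = - b"
    using n qo unfolding z by (simp_all add: light_cone_def
        bilinear_ladd[OF B(1)] bilinear_lmul[OF B(1)])
  then show "y = z + B z \<qq> *\<^sub>R \<oo> + B z \<oo> *\<^sub>R \<qq>"
    by (simp add: z)
qed

definition cone_lift :: "(real^'n \<Rightarrow> real^'n \<Rightarrow> real) \<Rightarrow> real^'n \<Rightarrow> real^'n \<Rightarrow> real^'n \<Rightarrow> real^'n" where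
  "cone_lift B \<oo> \<qq> x = \<oo> + x + (B x x / 2) *\<^sub>R \<qq>"

definition affine_null_lines ::
  "(real^'n \<Rightarrow> real^'n \<Rightarrow> real) \<Rightarrow> real^'n \<Rightarrow> real^'n \<Rightarrow> (real^'n) set set" where
  "affine_null_lines B \<oo> \<qq> = {{x + r *\<^sub>R v | r. r \<in> UNIV} | x v.
     x \<in> affine_part B \<oo> \<qq> \<and> v \<in> affine_part B \<oo> \<qq> \<and> v \<noteq> 0 \<and> B v v = 0}"

definition line_to_plane ::
  "(real^'n \<Rightarrow> real^'n \<Rightarrow> real) \<Rightarrow> real^'n \<Rightarrow> real^'n \<Rightarrow> (real^'n) set \<Rightarrow> (real^'n) set" where
  "line_to_plane B \<oo> \<qq> l = span (cone_lift B \<oo> \<qq> ` l)"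

lemma line_to_plane_eq:
  assumes B: "bilinear B" "\<And>x y. B x y = B y x" and v: "B v v = 0"
  shows "line_to_plane B \<oo> \<qq> {x + r *\<^sub>R v | r. r \<in> UNIV} =
     span {cone_lift B \<oo> \<qq> x, v + B x v *\<^sub>R \<qq>}" (is "?L = span {?p, ?d}")
proof -
  have pt: "cone_lift B \<oo> \<qq> (x + r *\<^sub>R v) = ?p + r *\<^sub>R ?d" for r
    using v B(2)[of v x]
    by (simp add: cone_lift_def bilinear_ladd[OF B(1)] bilinear_lmul[OF B(1)]
        bilinear_radd[OF B(1)] bilinear_rmul[OF B(1)] algebra_simps flip: scaleR_add_left)
  have im: "cone_lift B \<oo> \<qq> ` {x + r *\<^sub>R v | r. r \<in> UNIV} = range (\<lambda>r. ?p + r *\<^sub>R ?d)"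
    by (force simp: pt)
  have "range (\<lambda>r. ?p + r *\<^sub>R ?d) \<subseteq> span {?p, ?d}"
    by (auto intro!: span_add[OF span_base span_scale[OF span_base]])
  moreover have "{?p, ?d} \<subseteq> span (range (\<lambda>r. ?p + r *\<^sub>R ?d))" (is "_ \<subseteq> span ?R")
  proof -
    have p: "?p \<in> span ?R" by (rule span_base, rule range_eqI[of _ _ 0]) simp
    have "?p + ?d \<in> span ?R" by (rule span_base, rule range_eqI[of _ _ 1]) simp
    from span_diff[OF this p] p show ?thesis by simp
  qed
  ultimately show ?thesis
    unfolding line_to_plane_def im by (intro equalityI span_minimal subspace_span)
qed

definition stereoprojection ::
  "(real^'n \<Rightarrow> real^'n \<Rightarrow> real) \<Rightarrow> real^'n \<Rightarrow> real^'n \<Rightarrow> (int^'m) set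
     \<Rightarrow> (int^'m \<Rightarrow> (real^'n) set) \<Rightarrow> (int^'m \<Rightarrow> (real^'n) set) \<Rightarrow> bool" where
  "stereoprojection B \<oo> \<qq> S f L \<longleftrightarrow> (\<forall>i\<in>S. \<not> f i \<subseteq> {z. B \<qq> z = 0} \<and>
     L i \<in> affine_null_lines B \<oo> \<qq> \<and> f i = line_to_plane B \<oo> \<qq> (L i))"

end

theory Submission
  imports Defs
begin

text \<open>
  Write \<open>L i = x i + \<real> v i\<close>, so that \<open>L' i = x' i + \<real> v i\<close>, let \<open>f' i\<close> be the null plane of the
  line \<open>L' i\<close>, let \<open>\<phi>\<close> be the lift to the light cone and \<open>V i = v i + (x i, v i) \<qq>\<close>.

  Edges. Two neighbouring lines either cross or are parallel. If they cross at \<open>X\<close>, then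
  \<open>\<eta> j i = \<phi> X \<and> (\<alpha> V i + \<beta> V j) + c V i \<and> V j\<close> with \<open>c \<noteq> 0\<close>, and the equation for \<open>x'\<close> reads
  \<open>x' j - x' i = - (\<alpha> v i + \<beta> v j)\<close>. So \<open>L' i\<close> and \<open>L' j\<close> cross too, and \<open>-\<alpha>\<close>, \<open>\<beta>\<close> are the parameters
  of their crossing point. The dual form \<open>h\<close> is obtained by exchanging the roles of \<open>x\<close> and \<open>x'\<close>
  in this expression while keeping \<open>c\<close>. For parallel lines there is a similar exchange which
  turns \<open>c\<close> into \<open>1 / c\<close>. Both cases are collected in \<open>dual_edge\<close>; they show that \<open>f'\<close> is a Legendre
  map and, as the coefficient does not vanish, that \<open>h\<close> is nondegenerate on every edge.

  Closedness. Decompose bivectors along \<open>\<oo>\<close>, the affine space \<open>\<langle>\<oo>, \<qq>\<rangle>\<^sup>\<bottom>\<close> and \<open>\<qq>\<close>. The affine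
  component of \<open>h\<close> is that of \<open>\<eta>\<close> plus \<open>d(x \<and> x')\<close>, its component along \<open>\<oo> \<and> \<qq>\<close> is minus that of \<open>\<eta>\<close>
  minus \<open>d(x, x')\<close>, and the component of the form \<open>\<oo> \<and> u\<close> is \<open>- \<oo> \<and> dx\<close> (lemma \<open>dual_pairings\<close>). All these
  are closed, so the sum of \<open>h\<close> around a quadrilateral is \<open>Z \<and> \<qq>\<close> for some \<open>Z\<close> orthogonal to \<open>\<qq>\<close>.
  This bivector lies in the exterior square of the sum of the four planes \<open>f'\<close>, which is
  spanned by vectors \<open>a, b, c, d\<close> of the four meeting lines. Hence it vanishes unless both
  \<open>Z\<close> and \<open>\<qq>\<close> lie in that span.

  In the remaining case each of \<open>a, b, c, d\<close> is null and orthogonal to its two neighbours, and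
  \<open>\<qq>\<close> is a null combination of them. As no plane of \<open>f'\<close> is orthogonal to \<open>\<qq>\<close>, none of the four vectors
  is (lemma \<open>null_cycle\<close>). So the lines cross on all four edges, and \<open>a, b, c, d\<close> may be taken to be lifts of crossing points.
  Pairing the sum of \<open>h\<close> with the opposite corners \<open>b, d\<close> gives \<open>(b, d)\<close> times
  \<open>c\<^sub>1 (v i, v j) - c\<^sub>3 (v k, v l)\<close>, where \<open>c\<^sub>1\<close>, \<open>c\<^sub>3\<close> are the coefficients on the edges \<open>ij\<close>, \<open>kl\<close>. The
  second factor is the same for \<open>\<eta>\<close>, whose sum is zero. So the pairing with \<open>b, d\<close> vanishes, as does the
  one with \<open>a, c\<close>, and this forces \<open>Z\<close> to be a multiple of \<open>\<qq>\<close>.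
\<close>

section \<open>Exterior products and planes meeting in a line\<close>

lemma bilinear_wedge2: "bilinear (wedge2 :: real^'n \<Rightarrow> _)"
  by (auto simp: bilinear_def intro!: linearI simp: wedge2_def vec_eq_iff algebra_simps)

lemmas wedge2_simps =
  bilinear_ladd[OF bilinear_wedge2] bilinear_radd[OF bilinear_wedge2]
  bilinear_lsub[OF bilinear_wedge2] bilinear_rsub[OF bilinear_wedge2]
  bilinear_lmul[OF bilinear_wedge2] bilinear_rmul[OF bilinear_wedge2]
  bilinear_lneg[OF bilinear_wedge2] bilinear_rneg[OF bilinear_wedge2]

lemma wedge2_self [simp]: "wedge2 a a = 0"
  by (simp add: wedge2_def vec_eq_iff)

lemma linear_wedge3: "linear (\<lambda>\<omega>. wedge3 \<omega> c)"
  by (rule linearI) (simp_all add: wedge3_def vec_eq_iff algebra_simps)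

lemma wedge3_scale_right: "wedge3 \<omega> (r *\<^sub>R c) = r *\<^sub>R wedge3 \<omega> c"
  by (simp add: wedge3_def vec_eq_iff algebra_simps)

lemma wedge3_wedge2_eq_0: "wedge3 (wedge2 a b) a = 0" "wedge3 (wedge2 b a) a = 0"
  by (simp_all add: wedge3_def wedge2_def vec_eq_iff algebra_simps)

lemma ext_square_base: "a \<in> W \<Longrightarrow> b \<in> W \<Longrightarrow> wedge2 a b \<in> ext_square W"
  unfolding ext_square_def by (rule span_base) auto

lemma subspace_ext_square: "subspace (ext_square W)"
  by (simp add: ext_square_def)

lemma ext_square_mono: "U \<subseteq> W \<Longrightarrow> ext_square U \<subseteq> ext_square W"
  unfolding ext_square_def by (rule span_mono) auto

lemma ext_square_span3:
  assumes "\<omega> \<in> ext_square (span {a, b, c})"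
  obtains \<alpha> \<beta> \<gamma> where "\<omega> = \<alpha> *\<^sub>R wedge2 a b + \<beta> *\<^sub>R wedge2 a c + \<gamma> *\<^sub>R wedge2 b c"
proof -
  have "\<exists>\<alpha> \<beta> \<gamma>. \<omega> = \<alpha> *\<^sub>R wedge2 a b + \<beta> *\<^sub>R wedge2 a c + \<gamma> *\<^sub>R wedge2 b c"
    using assms unfolding ext_square_def
  proof (induction rule: span_induct_alt)
    case base
    show ?case by (intro exI[of _ 0]) simp
  next
    case (step r u \<tau>)
    obtain y z where yz: "u = wedge2 y z" "y \<in> span {a, b, c}" "z \<in> span {a, b, c}"
      using step.hyps by auto
    obtain y1 y2 y3 where y: "y = y1 *\<^sub>R a + (y2 *\<^sub>R b + y3 *\<^sub>R c)"
      using yz(2) by (auto simp: span_insert span_singleton algebra_simps)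
    obtain z1 z2 z3 where z: "z = z1 *\<^sub>R a + (z2 *\<^sub>R b + z3 *\<^sub>R c)"
      using yz(3) by (auto simp: span_insert span_singleton algebra_simps)
    obtain \<alpha> \<beta> \<gamma> where t: "\<tau> = \<alpha> *\<^sub>R wedge2 a b + \<beta> *\<^sub>R wedge2 a c + \<gamma> *\<^sub>R wedge2 b c"
      using step.IH by blast
    show ?case
      by (rule exI[of _ "\<alpha> + r * (y1 * z2 - y2 * z1)"], rule exI[of _ "\<beta> + r * (y1 * z3 - y3 * z1)"],
          rule exI[of _ "\<gamma> + r * (y2 * z3 - y3 * z2)"])
        (simp add: yz(1) y z t wedge2_def vec_eq_iff algebra_simps)
  qed
  with that show thesis by blast
qed

text \<open>Interior product of a bivector with the Euclidean functional \<open>y \<mapsto> \<xi> \<bullet> y\<close>. A functional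
  that vanishes on a subspace annihilates its exterior square.\<close>
definition contract :: "real^'n \<Rightarrow> real^'n^'n \<Rightarrow> real^'n" where
  "contract \<xi> \<omega> = (\<Sum>i\<in>UNIV. \<xi> $ i *\<^sub>R \<omega> $ i)"

lemma linear_contract: "linear (contract \<xi>)"
  by (rule linearI) (simp_all add: contract_def sum.distrib scaleR_add_right scaleR_sum_right mult.commute)

lemma contract_wedge2: "contract \<xi> (wedge2 a b) = (\<xi> \<bullet> a) *\<^sub>R b - (\<xi> \<bullet> b) *\<^sub>R a"
  by (simp add: contract_def wedge2_def vec_eq_iff inner_vec_def sum_distrib_left
      sum_distrib_right sum_subtractf algebra_simps)

lemma contract_ext_square:
  assumes "\<omega> \<in> ext_square W" "\<And>w. w \<in> W \<Longrightarrow> \<xi> \<bullet> w = 0"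
  shows "contract \<xi> \<omega> = 0"
  using assms(2)
  by (intro linear_eq_0_on_span[OF linear_contract _ assms(1)[unfolded ext_square_def]])
    (auto simp: contract_wedge2)

lemma exists_orthogonal_functional:
  fixes z :: "real^'n"
  assumes "subspace W" "z \<notin> W"
  obtains \<xi> where "\<And>w. w \<in> W \<Longrightarrow> \<xi> \<bullet> w = 0" "\<xi> \<bullet> z \<noteq> 0"
proof -
  obtain y \<xi> where yl: "y \<in> span W" "\<And>w. w \<in> span W \<Longrightarrow> orthogonal \<xi> w" "z = y + \<xi>"
    by (rule orthogonal_subspace_decomp_exists[of W z]) blast
  have "\<xi> \<noteq> 0" using yl(1,3) assms by (metis add.right_neutral span_eq_iff)
  moreover have "\<xi> \<bullet> y = 0" using yl(1,2) by (simp add: orthogonal_def)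
  ultimately have "\<xi> \<bullet> z \<noteq> 0" by (simp add: yl(3) inner_add_right)
  then show thesis using that yl(2) by (meson orthogonal_def span_base)
qed

text \<open>If a factor, say \<open>a\<close>, were outside \<open>W\<close>, a functional vanishing on \<open>W\<close> but not on \<open>a\<close> would
  annihilate the bivector and so make \<open>b\<close> a multiple of \<open>a\<close>.\<close>
lemma wedge2_in_ext_square_factors:
  fixes a b :: "real^'n"
  assumes "subspace W" "wedge2 a b \<in> ext_square W" "wedge2 a b \<noteq> 0"
  shows "a \<in> W \<and> b \<in> W"
proof -
  have *: "y \<in> W" if m: "wedge2 y z \<in> ext_square W" and n: "wedge2 y z \<noteq> 0" for y z :: "real^'n"
  proof (rule ccontr)
    assume "y \<notin> W"
    then obtain \<xi> where l: "\<And>w. w \<in> W \<Longrightarrow> \<xi> \<bullet> w = 0" "\<xi> \<bullet> y \<noteq> 0"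
      using exists_orthogonal_functional[OF assms(1)] by blast
    have "(\<xi> \<bullet> y) *\<^sub>R z = (\<xi> \<bullet> z) *\<^sub>R y"
      using contract_ext_square[OF m l(1)] by (simp add: contract_wedge2)
    then have "(\<xi> \<bullet> y) *\<^sub>R wedge2 y z = 0"
      by (simp flip: bilinear_rmul[OF bilinear_wedge2]) (simp add: bilinear_rmul[OF bilinear_wedge2])
    with l(2) n show False by simp
  qed
  have "wedge2 b a \<in> ext_square W" "wedge2 b a \<noteq> 0"
    using assms(2,3) subspace_neg[OF subspace_ext_square] by (auto simp: wedge2_swap[of b a])
  with *[of a b] *[of b a] assms(2,3) show ?thesis by blast
qed

lemma wedge2_eq_0_imp:
  fixes a b :: "real^'n"
  assumes "wedge2 a b = 0" "a \<noteq> 0"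
  shows "b \<in> span {a}"
proof -
  have "(a \<bullet> a) *\<^sub>R b = (a \<bullet> b) *\<^sub>R a"
    using contract_wedge2[of a a b] assms(1) by (simp add: linear_0[OF linear_contract])
  then have "b = ((a \<bullet> b) / (a \<bullet> a)) *\<^sub>R a"
    using assms(2) by (metis divideR_right inner_eq_zero_iff scaleR_scaleR divide_inverse_commute)
  then show ?thesis by (metis span_base span_scale singletonI)
qed

lemma wedge3_eq_0_imp:
  fixes a b c :: "real^'n"
  assumes "wedge3 (wedge2 a b) c = 0" "a \<noteq> 0" "b \<notin> span {a}"
  shows "c \<in> span {a, b}"
proof (rule ccontr)
  assume "c \<notin> span {a, b}"
  then obtain \<xi> where l: "\<And>w. w \<in> span {a, b} \<Longrightarrow> \<xi> \<bullet> w = 0" "\<xi> \<bullet> c \<noteq> 0"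
    using exists_orthogonal_functional[OF subspace_span] by blast
  have la: "\<xi> \<bullet> a = 0" and lb: "\<xi> \<bullet> b = 0" using l(1) by (auto intro: span_base)
  have "(\<Sum>k\<in>UNIV. \<xi> $ k * wedge3 (wedge2 a b) c $ i $ j $ k) = (\<xi> \<bullet> c) * wedge2 a b $ i $ j" for i j
  proof -
    have "(\<Sum>k\<in>UNIV. \<xi> $ k * wedge3 (wedge2 a b) c $ i $ j $ k) =
      (\<xi> \<bullet> c) * wedge2 a b $ i $ j + (\<xi> \<bullet> b) * (a $ j * c $ i - a $ i * c $ j)
        + (\<xi> \<bullet> a) * (b $ i * c $ j - b $ j * c $ i)"
      by (simp add: wedge3_def wedge2_def inner_vec_def sum_distrib_left sum_distrib_right
          sum_subtractf sum.distrib algebra_simps)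
    then show ?thesis by (simp add: la lb)
  qed
  then have "wedge2 a b = 0" using assms(1) l(2) by (simp add: vec_eq_iff)
  then show False using wedge2_eq_0_imp assms(2,3) by blast
qed

text \<open>A fourfold product of lines is the line of the product of their generators, and it vanishes
  when two generators are proportional. Independence of neighbours is what the argument for
  quadrilaterals extracts from regularity.\<close>
lemma wedge_spaces_nonzero_adjacent:
  assumes "wedge_spaces (span {a}) (span {b}) (span {c}) (span {d}) \<noteq> {0}"
  shows "a \<noteq> 0 \<and> b \<noteq> 0 \<and> c \<noteq> 0 \<and> d \<noteq> 0 \<and> b \<notin> span {a} \<and> c \<notin> span {b} \<and> d \<notin> span {c} \<and> a \<notin> span {d}"
proof -
  let ?w = "\<lambda>a b c d. wedge4 (wedge3 (wedge2 a b) c) d"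
  have nz: "?w a b c d \<noteq> 0"
  proof
    assume z: "?w a b c d = 0"
    have "?w (\<alpha> *\<^sub>R a) (\<beta> *\<^sub>R b) (\<gamma> *\<^sub>R c) (\<delta> *\<^sub>R d) = (\<alpha> * \<beta> * \<gamma> * \<delta>) *\<^sub>R ?w a b c d" for \<alpha> \<beta> \<gamma> \<delta>
      by (simp add: wedge4_def wedge3_def wedge2_def vec_eq_iff algebra_simps)
    then have "{?w a' b' c' d' |a' b' c' d'. a' \<in> span {a} \<and> b' \<in> span {b} \<and> c' \<in> span {c} \<and> d' \<in> span {d}} \<subseteq> {0}"
      using z by (auto simp: span_singleton)
    then have "wedge_spaces (span {a}) (span {b}) (span {c}) (span {d}) \<subseteq> {0}"
      unfolding wedge_spaces_def by (rule span_minimal) (simp add: subspace_0 subspace_def)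
    moreover have "0 \<in> wedge_spaces (span {a}) (span {b}) (span {c}) (span {d})"
      unfolding wedge_spaces_def by (rule span_zero)
    ultimately show False using assms by blast
  qed
  have z: "?w 0 b c d = 0" "?w a 0 c d = 0" "?w a b 0 d = 0" "?w a b c 0 = 0"
    "?w a (r *\<^sub>R a) c d = 0" "?w a b (r *\<^sub>R b) d = 0" "?w a b c (r *\<^sub>R c) = 0"
    "?w (r *\<^sub>R d) b c d = 0" for r
    by (simp_all add: wedge4_def wedge3_def wedge2_def vec_eq_iff algebra_simps)
  show ?thesis using nz z by (auto simp: span_singleton)
qed

lemma span_two_eq:
  fixes a b :: "real^'n"
  assumes "subspace W" "dim W = 2" "a \<in> W" "b \<in> W" "a \<noteq> 0" "b \<notin> span {a}"
  shows "W = span {a, b}"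
proof -
  have ab: "b \<noteq> a" using assms(6) span_base by blast
  have ind: "independent {b, a}" using assms(5,6) by (simp add: independent_insert)
  have "dim (span {b, a}) = 2" using dim_eq_card_independent[OF ind] ab by simp
  then have "span {b, a} = W"
    using assms by (intro subspace_dim_equal) (simp_all add: span_minimal)
  then show ?thesis by (simp add: insert_commute)
qed

text \<open>The plane of a line is computed from a base point and a direction; this and the next lemma
  make it independent of the choice of both.\<close>
lemma span_shear: "span {a + r *\<^sub>R b, b} = span {a, b}"
proof -
  have "a + r *\<^sub>R b \<in> span {a, b}" by (intro span_add span_scale span_base) auto
  moreover have "a + r *\<^sub>R b - r *\<^sub>R b \<in> span {a + r *\<^sub>R b, b}"
    by (intro span_diff span_scale span_base) auto
  ultimately show ?thesis by (simp add: span_eq span_base)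
qed

lemma span_scale_second: "r \<noteq> 0 \<Longrightarrow> span {a, r *\<^sub>R b} = span {a, b}"
proof -
  assume r: "r \<noteq> 0"
  have "inverse r *\<^sub>R (r *\<^sub>R b) \<in> span {a, r *\<^sub>R b}"
    by (intro span_scale span_base) auto
  moreover have "r *\<^sub>R b \<in> span {a, b}" by (intro span_scale span_base) auto
  ultimately show ?thesis using r by (simp add: span_eq span_base)
qed

text \<open>Regularity on an edge says that \<open>a, b, c\<close> are independent.\<close>
lemma meeting_planes:
  fixes a b c :: "real^'n"
  assumes d: "dim (sum_space (span {a, b}) (span {a, c})) = 3"
  shows "sum_space (span {a, b}) (span {a, c}) = span {a, b, c}"
    and "span {a, b} \<inter> span {a, c} = span {a}"
    and "b \<noteq> 0" "c \<notin> span {b}" "a \<notin> span {b, c}"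
proof -
  show s: "sum_space (span {a, b}) (span {a, c}) = span {a, b, c}"
  proof -
    have "sum_space (span {a, b}) (span {a, c}) = span ({a, b} \<union> {a, c})"
      unfolding sum_space_def span_Un by auto
    then show ?thesis by (simp add: insert_commute)
  qed
  have d3: "dim {a, b, c} = 3" using d s by simp
  have c3: "card {a, b, c} = 3"
    using dim_le_card'[of "{a, b, c}"] d3 card_insert_le_m1[of 3 "{b,c}" a] card_insert_le_m1[of 2 "{c}" b] by auto
  have ind: "independent {a, b, c}"
    by (rule card_le_dim_spanning[of _ "span {a, b, c}"]) (use d3 c3 in \<open>auto intro: span_base\<close>)
  have ne: "a \<noteq> b" "a \<noteq> c" "b \<noteq> c" using c3 by (auto simp: card_insert_if split: if_splits)
  show abc: "a \<notin> span {b, c}" using ind ne by (simp add: independent_insert)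
  have "independent {c, b}" using ind by (rule independent_mono) auto
  then show "b \<noteq> 0" "c \<notin> span {b}" using ne by (auto simp: independent_insert)
  have "independent {b, a, c}" using ind by (simp add: insert_commute)
  then have bac: "b \<notin> span {a, c}" using ne by (simp add: independent_insert)
  show "span {a, b} \<inter> span {a, c} = span {a}"
  proof
    show "span {a, b} \<inter> span {a, c} \<subseteq> span {a}"
    proof
      fix y assume y: "y \<in> span {a, b} \<inter> span {a, c}"
      then obtain r s where rs: "y = r *\<^sub>R a + s *\<^sub>R b"
        by (auto simp: span_insert span_singleton algebra_simps)
      have "s *\<^sub>R b \<in> span {a, c}"
        using span_diff[of y "{a, c}" "r *\<^sub>R a"] y rs by (auto simp: span_base span_scale)
      then have "s = 0"
        using bac span_scale[of "s *\<^sub>R b" "{a, c}" "inverse s"] by (cases "s = 0") simp_all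
      then show "y \<in> span {a}" using rs by (simp add: span_base span_scale)
    qed
    show "span {a} \<subseteq> span {a, b} \<inter> span {a, c}"
      using span_mono[of "{a}" "{a, b}"] span_mono[of "{a}" "{a, c}"] by blast
  qed
qed

text \<open>Multiplying by \<open>a\<close> kills the two terms that contain \<open>a\<close>, so nondegeneracy on an edge is a
  condition on the coefficient of \<open>b \<and> c\<close> alone. This is the coefficient that must
  not vanish in the dual form.\<close>
lemma biv_wedge_space_line:
  assumes "\<omega> = \<alpha> *\<^sub>R wedge2 a b + \<beta> *\<^sub>R wedge2 a c + \<gamma> *\<^sub>R wedge2 b c"
    and d: "dim (sum_space (span {a, b}) (span {a, c})) = 3"
  shows "biv_wedge_space \<omega> (span {a, b} \<inter> span {a, c}) \<noteq> {0} \<longleftrightarrow> \<gamma> \<noteq> 0"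
proof -
  note m = meeting_planes[OF d]
  have w: "wedge3 \<omega> a = \<gamma> *\<^sub>R wedge3 (wedge2 b c) a"
    by (simp add: assms(1) linear_add[OF linear_wedge3] linear_scale[OF linear_wedge3] wedge3_wedge2_eq_0)
  have nz: "wedge3 (wedge2 b c) a \<noteq> 0"
    using wedge3_eq_0_imp[of b c a] m(3-5) by blast
  have in_space: "wedge3 \<omega> a \<in> biv_wedge_space \<omega> (span {a})"
    unfolding biv_wedge_space_def by (rule span_base) (auto intro: span_base)
  have "biv_wedge_space \<omega> (span {a}) = {0}" if "\<gamma> = 0"
  proof -
    have "{wedge3 \<omega> y | y. y \<in> span {a}} \<subseteq> {0}"
      using w that by (auto simp: span_singleton wedge3_scale_right)
    then have "biv_wedge_space \<omega> (span {a}) \<subseteq> {0}"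
      unfolding biv_wedge_space_def by (rule span_minimal) (simp add: subspace_def)
    then show ?thesis unfolding biv_wedge_space_def using span_zero by blast
  qed
  moreover have "biv_wedge_space \<omega> (span {a}) \<noteq> {0}" if "\<gamma> \<noteq> 0"
    using in_space that nz unfolding w by fastforce
  ultimately show ?thesis unfolding m(2) by blast
qed

lemma sum_space_commute: "sum_space U W = sum_space W U"
  by (auto simp: sum_space_def) (metis add.commute)+

section \<open>Lifting the affine space to the light cone\<close>

text \<open>Nondegeneracy makes a bivector determined by its pairings with vectors.\<close>
locale stereo_frame =
  fixes B :: "real^'n \<Rightarrow> real^'n \<Rightarrow> real" and \<oo> \<qq> :: "real^'n"
  assumes bil: "bilinear B"
    and sym: "\<And>y z. B y z = B z y"
    and nondeg: "\<And>y. (\<And>z. B y z = 0) \<Longrightarrow> y = 0"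
    and oo: "B \<oo> \<oo> = 0" and qq: "B \<qq> \<qq> = 0" and oq: "B \<oo> \<qq> = -1"
begin

lemmas B_simps =
  bilinear_ladd[OF bil] bilinear_radd[OF bil] bilinear_lsub[OF bil] bilinear_rsub[OF bil]
  bilinear_lmul[OF bil] bilinear_rmul[OF bil] bilinear_lneg[OF bil] bilinear_rneg[OF bil]
  bilinear_lzero[OF bil] bilinear_rzero[OF bil]

lemma qo: "B \<qq> \<oo> = -1" using sym oq by metis

abbreviation aff :: "(real^'n) set" where "aff \<equiv> affine_part B \<oo> \<qq>"

lemma affD:
  assumes "y \<in> aff"
  shows "B \<oo> y = 0" "B \<qq> y = 0" "B y \<oo> = 0" "B y \<qq> = 0"
  using assms sym by (auto simp: affine_part_iff[OF bil])

lemma affI: "B \<oo> y = 0 \<Longrightarrow> B \<qq> y = 0 \<Longrightarrow> y \<in> aff"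
  by (simp add: affine_part_iff[OF bil])

lemma aff_decomp:
  obtains u \<alpha> \<beta> where "u \<in> aff" "y = u + \<alpha> *\<^sub>R \<oo> + \<beta> *\<^sub>R \<qq>"
proof -
  let ?u = "y + B y \<qq> *\<^sub>R \<oo> + B y \<oo> *\<^sub>R \<qq>"
  have "?u \<in> aff" by (rule affI) (simp_all add: B_simps oo qq oq qo sym)
  then show thesis by (rule that[of _ "- B y \<qq>" "- B y \<oo>"]) simp
qed

lemma proj_eq: "affine_proj B \<oo> \<qq> z = z + B z \<qq> *\<^sub>R \<oo> + B z \<oo> *\<^sub>R \<qq>"
  using affine_proj_eq[OF bil sym] oo qq oq by (simp add: light_cone_def)

abbreviation lift :: "real^'n \<Rightarrow> real^'n" where "lift \<equiv> cone_lift B \<oo> \<qq>"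

text \<open>The derivative of the lift along \<open>v\<close> at \<open>x\<close>. For null \<open>v\<close> it does not change along the line in
  direction \<open>v\<close>, so it depends on the line only.\<close>
definition dir_lift :: "real^'n \<Rightarrow> real^'n \<Rightarrow> real^'n" where
  "dir_lift x v = v + B x v *\<^sub>R \<qq>"

abbreviation plane :: "real^'n \<Rightarrow> real^'n \<Rightarrow> (real^'n) set" where
  "plane x v \<equiv> span {lift x, dir_lift x v}"

abbreviation null_dir :: "real^'n \<Rightarrow> bool" where
  "null_dir v \<equiv> v \<in> aff \<and> v \<noteq> 0 \<and> B v v = 0"

lemma lift_products:
  assumes "x \<in> aff"
  shows "B \<qq> (lift x) = -1" "B (lift x) \<qq> = -1" "B (lift x) \<oo> = - B x x / 2"
    "B (lift x) (lift x) = 0" "y \<in> aff \<Longrightarrow> B (lift x) y = B x y" "y \<in> aff \<Longrightarrow> B y (lift x) = B y x"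
  by (simp_all add: cone_lift_def B_simps affD assms oo qq oq qo)

lemma dir_lift_products:
  assumes "v \<in> aff"
  shows "B \<qq> (dir_lift x v) = 0" "B (dir_lift x v) \<qq> = 0" "B (dir_lift x v) \<oo> = - B x v"
    "y \<in> aff \<Longrightarrow> B (dir_lift x v) y = B v y" "y \<in> aff \<Longrightarrow> B y (dir_lift x v) = B y v"
    "w \<in> aff \<Longrightarrow> B (dir_lift x v) (dir_lift y w) = B v w"
    "z \<in> aff \<Longrightarrow> B (lift z) (dir_lift x v) = B z v - B x v"
    "z \<in> aff \<Longrightarrow> B (dir_lift x v) (lift z) = B z v - B x v"
  using assms by (simp_all add: dir_lift_def cone_lift_def B_simps affD oo qq oq qo sym[of v z])

lemma aff_add [intro]: "x \<in> aff \<Longrightarrow> y \<in> aff \<Longrightarrow> x + y \<in> aff"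
  and aff_scale [intro]: "x \<in> aff \<Longrightarrow> r *\<^sub>R x \<in> aff"
  by (simp_all add: affine_part_iff[OF bil] B_simps)

lemma dir_lift_shift: "B v v = 0 \<Longrightarrow> dir_lift (x + r *\<^sub>R v) v = dir_lift x v"
  by (simp add: dir_lift_def B_simps)

lemma dir_lift_scale: "dir_lift x (r *\<^sub>R v) = r *\<^sub>R dir_lift x v"
  by (simp add: dir_lift_def B_simps algebra_simps)

lemma lift_shift: "B v v = 0 \<Longrightarrow> lift (x + r *\<^sub>R v) = lift x + r *\<^sub>R dir_lift x v"
  by (simp add: cone_lift_def dir_lift_def B_simps sym[of v x] algebra_simps flip: scaleR_add_left)

lemma dir_lift_nonzero: "null_dir v \<Longrightarrow> dir_lift x v \<noteq> 0"
proof
  assume v: "null_dir v" and z: "dir_lift x v = 0"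
  have "B \<oo> (dir_lift x v) = - B x v" using v by (simp add: dir_lift_def B_simps affD oq)
  then have "B x v = 0" using z by (simp add: B_simps)
  then show False using v z by (simp add: dir_lift_def)
qed

lemma plane_shift:
  assumes "B v v = 0"
  shows "plane (x + r *\<^sub>R v) v = plane x v"
proof -
  show ?thesis by (simp add: lift_shift dir_lift_shift assms span_shear)
qed

lemma plane_scale: "r \<noteq> 0 \<Longrightarrow> plane x (r *\<^sub>R v) = plane x v"
  by (simp add: dir_lift_scale span_scale_second)

lemma line_to_plane_eq_plane:
  "B v v = 0 \<Longrightarrow> line_to_plane B \<oo> \<qq> {x + r *\<^sub>R v | r. r \<in> UNIV} = plane x v"
  unfolding dir_lift_def by (rule line_to_plane_eq[OF bil sym])

section \<open>Bivectors as alternating forms\<close>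

text \<open>Bivectors are compared through their values as alternating forms: on \<open>a \<and> b\<close> this is the
  \<open>2 \<times> 2\<close> minor \<open>(a, y) (b, z) - (b, y) (a, z)\<close>, so every identity becomes one between scalars.\<close>
abbreviation pairing :: "real^'n^'n \<Rightarrow> real^'n \<Rightarrow> real^'n \<Rightarrow> real" where
  "pairing \<omega> y z \<equiv> B (biv_act B \<omega> y) z"

lemma linear_biv_act: "linear (\<lambda>\<omega>. biv_act B \<omega> z)"
  by (rule linearI) (simp_all add: biv_act_def sum.distrib scaleR_add_right scaleR_sum_right mult.commute)

lemma pairing_simps:
  "pairing (wedge2 a b) y z = B a y * B b z - B b y * B a z"
  "pairing (\<omega> + \<tau>) y z = pairing \<omega> y z + pairing \<tau> y z"
  "pairing (\<omega> - \<tau>) y z = pairing \<omega> y z - pairing \<tau> y z"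
  "pairing (- \<omega>) y z = - pairing \<omega> y z"
  "pairing (r *\<^sub>R \<omega>) y z = r * pairing \<omega> y z"
  "pairing 0 y z = 0"
  by (simp_all add: biv_act_wedge2[OF bil] B_simps linear_add[OF linear_biv_act] linear_0[OF linear_biv_act]
      linear_diff[OF linear_biv_act] linear_neg[OF linear_biv_act] linear_scale[OF linear_biv_act])

lemma linear_biv_act_right: "linear (biv_act B \<omega>)"
  by (rule linearI) (simp_all add: biv_act_def B_simps scaleR_add_left sum.distrib scaleR_sum_right)

lemma pairing_args:
  "pairing \<omega> (y + y') z = pairing \<omega> y z + pairing \<omega> y' z"
  "pairing \<omega> (r *\<^sub>R y) z = r * pairing \<omega> y z"
  "pairing \<omega> y (z + z') = pairing \<omega> y z + pairing \<omega> y z'"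
  "pairing \<omega> y (r *\<^sub>R z) = r * pairing \<omega> y z"
  by (simp_all add: B_simps linear_add[OF linear_biv_act_right] linear_scale[OF linear_biv_act_right])

lemma pairing_swap:
  assumes "\<omega> \<in> ext_square W"
  shows "pairing \<omega> z y = - pairing \<omega> y z"
proof -
  have "linear (\<lambda>\<omega>. pairing \<omega> z y + pairing \<omega> y z)"
    by (rule linearI) (simp_all add: pairing_simps algebra_simps)
  then have "pairing \<omega> z y + pairing \<omega> y z = 0"
    by (rule linear_eq_0_on_span[OF _ _ assms[unfolded ext_square_def]])
      (auto simp: pairing_simps)
  then show ?thesis by simp
qed

text \<open>By nondegeneracy there are vectors dual to the coordinate basis, and acting on them reads off
  the rows of the bivector.\<close>
lemma pairing_nondeg:
  assumes "\<And>y z. pairing \<omega> y z = 0"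
  shows "\<omega> = 0"
proof -
  let ?g = "\<lambda>y. (\<chi> i. B (axis i 1) y) :: real^'n"
  have lin: "linear ?g" by (rule linearI) (simp_all add: B_simps vec_eq_iff)
  have "inj ?g"
  proof (rule linear_injective_0[OF lin, THEN iffD2], intro allI impI)
    fix y assume "?g y = 0"
    then have ax: "B y (axis i 1) = 0" for i by (simp add: vec_eq_iff sym)
    show "y = 0"
    proof (rule nondeg)
      fix z
      have "linear (B y)" using bil by (simp add: bilinear_def)
      then show "B y z = 0"
        using linear_sum[of "B y" "\<lambda>i. z $ i *\<^sub>R axis i 1" UNIV] basis_expansion[of z]
        by (simp add: scalar_mult_eq_scaleR B_simps ax)
    qed
  qed
  then have surj: "surj ?g" using linear_injective_imp_surjective lin by blast
  have "\<omega> $ k = 0" for k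
  proof -
    obtain y where g: "axis k 1 = ?g y" using surjD[OF surj, of "axis k 1"] by (rule exE)
    have y: "B (axis i 1) y = (if i = k then 1 else 0)" for i
      using arg_cong[OF g, of "\<lambda>u. u $ i"] by (simp add: axis_def)
    have "biv_act B \<omega> y = 0" by (rule nondeg) (rule assms)
    moreover have "biv_act B \<omega> y = (\<Sum>i\<in>UNIV. if i = k then \<omega> $ k else 0)"
      unfolding biv_act_def by (rule sum.cong) (auto simp: y)
    ultimately show ?thesis by simp
  qed
  then show ?thesis by (simp add: vec_eq_iff)
qed

text \<open>The hypotheses say that \<open>\<qq>\<close> is mapped to zero and that the affine component vanishes. Only the
  component \<open>Z \<and> \<qq>\<close> with \<open>Z\<close> affine is left, and acting on \<open>\<oo>\<close> recovers \<open>Z\<close>.\<close>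
lemma eq_wedge_q_of_pairings:
  assumes E: "E \<in> ext_square W"
    and uv: "\<And>y z. y \<in> aff \<Longrightarrow> z \<in> aff \<Longrightarrow> pairing E y z = 0"
    and qz: "\<And>z. z \<in> aff \<Longrightarrow> pairing E \<qq> z = 0"
    and oq0: "pairing E \<oo> \<qq> = 0"
  obtains Z where "E = wedge2 Z \<qq>" "B \<qq> Z = 0"
proof -
  note sw = pairing_swap[OF E]
  have diag: "pairing E y y = 0" for y using sw[of y y] by simp
  define Z where "Z = biv_act B E \<oo>"
  have Zz: "B Z z = pairing E \<oo> z" for z by (simp add: Z_def)
  have Z: "Z \<in> aff" using Zz[of \<qq>] Zz[of \<oo>] oq0 diag sym[of Z] by (intro affI) simp_all
  have "E - wedge2 Z \<qq> = 0"
  proof (rule pairing_nondeg)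
    fix y z
    obtain y0 y1 y2 where y: "y0 \<in> aff" "y = y0 + y1 *\<^sub>R \<oo> + y2 *\<^sub>R \<qq>" by (rule aff_decomp)
    obtain z0 z1 z2 where z: "z0 \<in> aff" "z = z0 + z1 *\<^sub>R \<oo> + z2 *\<^sub>R \<qq>" by (rule aff_decomp)
    show "pairing (E - wedge2 Z \<qq>) y z = 0"
      using y(1) z(1) Z
      by (simp add: y(2) z(2) pairing_simps pairing_args uv qz oq0 diag sw[of \<qq> \<oo>] sw[of y0 \<qq>] sw[of y0 \<oo>]
          Zz[symmetric] B_simps affD oo qq oq qo qz)
  qed
  then have "E = wedge2 Z \<qq>" by simp
  then show thesis using that Z affD by blast
qed

section \<open>Dual bivectors on an edge\<close>

text \<open>Normal form of a bivector over an edge whose lines cross; \<open>r\<close> and \<open>s\<close> are the parameters of the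
  crossing point on the two lines.\<close>
definition crossing_form where
  "crossing_form x v y w r s \<alpha> \<beta> c \<omega> \<longleftrightarrow> x + r *\<^sub>R v = y + s *\<^sub>R w \<and>
     \<omega> = wedge2 (lift (x + r *\<^sub>R v)) (\<alpha> *\<^sub>R dir_lift x v + \<beta> *\<^sub>R dir_lift y w)
         + c *\<^sub>R wedge2 (dir_lift x v) (dir_lift y w)"

text \<open>The duality exchanges the parameters of the two crossing points, up to sign, and keeps the
  coefficient \<open>c\<close>.\<close>
definition crossing_dual where
  "crossing_dual x v x' y w y' \<omega> \<omega>' \<longleftrightarrow> (\<exists>r s r' s' c. c \<noteq> 0 \<and>
     crossing_form x v y w r s (- r') s' c \<omega> \<and> crossing_form x' v y' w r' s' (- r) s c \<omega>')"

text \<open>Normal form over an edge whose lines are parallel: both planes contain \<open>dir_lift x v\<close>, and \<open>\<gamma>\<close> is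
  the coefficient responsible for nondegeneracy.\<close>
definition parallel_form where
  "parallel_form x v y \<alpha> \<beta> \<gamma> \<omega> \<longleftrightarrow> B (y - x) v = 0 \<and>
     \<omega> = \<alpha> *\<^sub>R wedge2 (lift x) (dir_lift x v) + \<beta> *\<^sub>R wedge2 (lift y) (dir_lift x v)
         + \<gamma> *\<^sub>R wedge2 (lift x) (lift y)"

text \<open>Here \<open>dx'\<close> and \<open>dx\<close> are proportional modulo \<open>v\<close> with factor \<open>- c\<close>, hence the inverse factor in the
  dual form. The exchange of \<open>\<alpha>\<close> and \<open>\<beta>\<close> is dictated by the affine component: it has to change by
  the exact form \<open>d(x \<and> x')\<close>.\<close>
definition parallel_dual where
  "parallel_dual x v x' y w y' \<omega> \<omega>' \<longleftrightarrow> (\<exists>\<rho> \<alpha> \<beta> c. \<rho> \<noteq> 0 \<and> w = \<rho> *\<^sub>R v \<and> c \<noteq> 0 \<and>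
     y' - x' = - ((\<alpha> + \<beta>) *\<^sub>R v + c *\<^sub>R (y - x)) \<and>
     parallel_form x v y \<alpha> \<beta> c \<omega> \<and> parallel_form x' v y' (\<beta> / c) (\<alpha> / c) (1 / c) \<omega>')"

definition dual_edge where
  "dual_edge x v x' y w y' \<omega> \<omega>' \<longleftrightarrow>
     crossing_dual x v x' y w y' \<omega> \<omega>' \<or> parallel_dual x v x' y w y' \<omega> \<omega>'"

text \<open>These three identities say that \<open>\<omega>'\<close>, apart from its component along vectors \<open>Z \<and> \<qq>\<close>, is obtained
  from \<open>\<omega>\<close> by a linear map and the addition of differences of functions at the end-points, so that
  this part of the dual form is closed. Both lines are rewritten from their crossing point, after
  which the identities are bilinear algebra.\<close>
lemma crossing_pairings:
  assumes "crossing_dual x v x' y w y' \<omega> \<omega>'"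
    and a: "x \<in> aff" "x' \<in> aff" "y \<in> aff" "y' \<in> aff" "null_dir v" "null_dir w"
  shows "u \<in> aff \<Longrightarrow> z \<in> aff \<Longrightarrow> pairing \<omega>' u z = pairing \<omega> u z + pairing (wedge2 y y' - wedge2 x x') u z"
    and "z \<in> aff \<Longrightarrow> pairing \<omega>' \<qq> z = B (y - x) z"
    and "pairing \<omega>' \<oo> \<qq> = - pairing \<omega> \<oo> \<qq> + B y y' - B x x'"
proof -
  obtain r s r' s' c where
    e: "x + r *\<^sub>R v = y + s *\<^sub>R w" "x' + r' *\<^sub>R v = y' + s' *\<^sub>R w" and
    f: "\<omega> = wedge2 (lift (x + r *\<^sub>R v)) (- r' *\<^sub>R dir_lift x v + s' *\<^sub>R dir_lift y w)
         + c *\<^sub>R wedge2 (dir_lift x v) (dir_lift y w)" and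
    f': "\<omega>' = wedge2 (lift (x' + r' *\<^sub>R v)) (- r *\<^sub>R dir_lift x' v + s *\<^sub>R dir_lift y' w)
         + c *\<^sub>R wedge2 (dir_lift x' v) (dir_lift y' w)"
    using assms(1) unfolding crossing_dual_def crossing_form_def by blast
  \<comment> \<open>Both lines of each family are expanded from their crossing point.\<close>
  define X where "X = x + r *\<^sub>R v"
  define X' where "X' = x' + r' *\<^sub>R v"
  have X: "X \<in> aff" "X' \<in> aff" using a by (auto simp: X_def X'_def)
  have v: "v \<in> aff" "w \<in> aff" "B v v = 0" "B w w = 0" using a by auto
  have x: "x = X - r *\<^sub>R v" "x' = X' - r' *\<^sub>R v" "y = X - s *\<^sub>R w" "y' = X' - s' *\<^sub>R w"
    using e by (simp_all add: X_def X'_def algebra_simps)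
  have dl: "dir_lift x v = dir_lift X v" "dir_lift x' v = dir_lift X' v"
    "dir_lift y w = dir_lift X w" "dir_lift y' w = dir_lift X' w"
    unfolding x using v by (simp_all add: dir_lift_def B_simps)
  have w: "\<omega> = wedge2 (lift X) (- r' *\<^sub>R dir_lift X v + s' *\<^sub>R dir_lift X w)
         + c *\<^sub>R wedge2 (dir_lift X v) (dir_lift X w)"
    "\<omega>' = wedge2 (lift X') (- r *\<^sub>R dir_lift X' v + s *\<^sub>R dir_lift X' w)
         + c *\<^sub>R wedge2 (dir_lift X' v) (dir_lift X' w)"
    unfolding f f' dl X_def X'_def by simp_all
  show "u \<in> aff \<Longrightarrow> z \<in> aff \<Longrightarrow> pairing \<omega>' u z = pairing \<omega> u z + pairing (wedge2 y y' - wedge2 x x') u z"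
    unfolding w x using v X
    by (simp add: pairing_simps B_simps lift_products dir_lift_products algebra_simps)
  show "z \<in> aff \<Longrightarrow> pairing \<omega>' \<qq> z = B (y - x) z"
    unfolding w x using v X
    by (simp add: pairing_simps B_simps lift_products dir_lift_products algebra_simps)
  show "pairing \<omega>' \<oo> \<qq> = - pairing \<omega> \<oo> \<qq> + B y y' - B x x'"
    unfolding w x using v X
    by (simp add: pairing_simps B_simps lift_products dir_lift_products sym[of v X] sym[of w X]
       sym[of v X'] sym[of w X'] algebra_simps)
qed

lemma parallel_pairings:
  assumes "parallel_dual x v x' y w y' \<omega> \<omega>'"
    and a: "x \<in> aff" "x' \<in> aff" "y \<in> aff" "y' \<in> aff" "null_dir v"
  shows "u \<in> aff \<Longrightarrow> z \<in> aff \<Longrightarrow> pairing \<omega>' u z = pairing \<omega> u z + pairing (wedge2 y y' - wedge2 x x') u z"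
    and "z \<in> aff \<Longrightarrow> pairing \<omega>' \<qq> z = B (y - x) z"
    and "pairing \<omega>' \<oo> \<qq> = - pairing \<omega> \<oo> \<qq> + B y y' - B x x'"
proof -
  obtain \<alpha> \<beta> c where c: "c \<noteq> 0" and e: "y' - x' = - ((\<alpha> + \<beta>) *\<^sub>R v + c *\<^sub>R (y - x))"
    and p: "B (y - x) v = 0"
    and f: "\<omega> = \<alpha> *\<^sub>R wedge2 (lift x) (dir_lift x v) + \<beta> *\<^sub>R wedge2 (lift y) (dir_lift x v)
         + c *\<^sub>R wedge2 (lift x) (lift y)"
    and f': "\<omega>' = (\<beta> / c) *\<^sub>R wedge2 (lift x') (dir_lift x' v) + (\<alpha> / c) *\<^sub>R wedge2 (lift y') (dir_lift x' v)
         + (1 / c) *\<^sub>R wedge2 (lift x') (lift y')"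
    using assms(1) unfolding parallel_dual_def parallel_form_def by blast
  \<comment> \<open>Everything is expressed through \<open>x\<close>, \<open>x'\<close>, \<open>v\<close> and \<open>d\<close>, where \<open>d\<close> and \<open>v\<close> are orthogonal.\<close>
  define d where "d = y - x"
  have y: "y = x + d" by (simp add: d_def)
  have y': "y' = x' - (\<alpha> + \<beta>) *\<^sub>R v - c *\<^sub>R d" using e by (simp add: d_def algebra_simps)
  have d: "d \<in> aff" using a by (auto simp: d_def affine_part_iff[OF bil] B_simps)
  have v: "v \<in> aff" "B v v = 0" "B d v = 0" "B v d = 0" using a p sym by (auto simp: d_def)
  note S = pairing_simps lift_products dir_lift_products
  show "pairing \<omega>' u z = pairing \<omega> u z + pairing (wedge2 y y' - wedge2 x x') u z" if "u \<in> aff" "z \<in> aff"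
  proof -
    have p1: "pairing \<omega> u z = \<alpha> * (B x u * B v z - B v u * B x z) + \<beta> * (B y u * B v z - B v u * B y z)
        + c * (B x u * B y z - B y u * B x z)"
      unfolding f using a v that by (simp add: S)
    have p2: "pairing \<omega>' u z = \<beta> / c * (B x' u * B v z - B v u * B x' z)
        + \<alpha> / c * (B y' u * B v z - B v u * B y' z) + 1 / c * (B x' u * B y' z - B y' u * B x' z)"
      unfolding f' using a v that by (simp add: S)
    show ?thesis unfolding p1 p2 using c by (simp add: y y' pairing_simps B_simps field_simps)
  qed
  show "pairing \<omega>' \<qq> z = B (y - x) z" if "z \<in> aff"
  proof -
    have "pairing \<omega>' \<qq> z = - (\<beta> / c * B v z) - \<alpha> / c * B v z + 1 / c * (B x' z - B y' z)"
      unfolding f' using a v that by (simp add: S field_simps)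
    then show ?thesis using c by (simp add: y y' B_simps field_simps)
  qed
  show "pairing \<omega>' \<oo> \<qq> = - pairing \<omega> \<oo> \<qq> + B y y' - B x x'"
  proof -
    have p1: "pairing \<omega> \<oo> \<qq> = - ((\<alpha> + \<beta>) * B x v) + c * (B x x - B y y) / 2"
      unfolding f using a v by (simp add: S algebra_simps diff_divide_distrib)
    have p2: "pairing \<omega>' \<oo> \<qq> = - ((\<beta> + \<alpha>) / c * B x' v) + 1 / c * (B x' x' - B y' y') / 2"
      unfolding f' using a v by (simp add: S add_divide_distrib diff_divide_distrib algebra_simps)
    show ?thesis unfolding p1 p2 using c v
      by (simp add: y y' B_simps sym[of v x] sym[of v x'] sym[of d x] sym[of d x'] field_simps)
  qed
qed

lemma dual_pairings:
  assumes "dual_edge x v x' y w y' \<omega> \<omega>'"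
    and "x \<in> aff" "x' \<in> aff" "y \<in> aff" "y' \<in> aff" "null_dir v" "null_dir w"
  shows "u \<in> aff \<Longrightarrow> z \<in> aff \<Longrightarrow> pairing \<omega>' u z = pairing \<omega> u z + pairing (wedge2 y y' - wedge2 x x') u z"
    and "z \<in> aff \<Longrightarrow> pairing \<omega>' \<qq> z = B (y - x) z"
    and "pairing \<omega>' \<oo> \<qq> = - pairing \<omega> \<oo> \<qq> + B y y' - B x x'"
  by (rule disjE[OF assms(1)[unfolded dual_edge_def]];
      (rule crossing_pairings[OF _ assms(2-7)] parallel_pairings[OF _ assms(2-6)]; assumption))+

lemma crossing_planes:
  assumes "x + r *\<^sub>R v = y + s *\<^sub>R w" "null_dir v" "null_dir w"
  shows "plane x v = span {lift (x + r *\<^sub>R v), dir_lift x v}"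
    and "plane y w = span {lift (x + r *\<^sub>R v), dir_lift y w}"
  using plane_shift[of v x r] plane_shift[of w y s] dir_lift_shift[of v x r] dir_lift_shift[of w y s] assms
  by simp_all

lemma dir_lift_perp_shift:
  assumes "B (y - x) v = 0"
  shows "dir_lift y v = dir_lift x v"
  using assms by (simp add: dir_lift_def B_simps)

lemma parallel_planes:
  assumes "w = \<rho> *\<^sub>R v" "\<rho> \<noteq> 0" "B (y - x) v = 0"
  shows "plane x v = span {dir_lift x v, lift x}"
    and "plane y w = span {dir_lift x v, lift y}"
  using plane_scale[of \<rho> y v] dir_lift_perp_shift[OF assms(3)] assms by (simp_all add: insert_commute)

text \<open>Compare the coefficients of a common vector: if its pairing with \<open>\<qq>\<close> is non-zero, it is the lift
  of a common point, otherwise it is the lift of a common direction.\<close>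
lemma planes_meet_cases:
  assumes a: "x \<in> aff" "y \<in> aff" "null_dir v" "null_dir w"
    and m: "plane x v \<inter> plane y w \<noteq> {0}"
  obtains r s where "x + r *\<^sub>R v = y + s *\<^sub>R w"
  | \<rho> where "\<rho> \<noteq> 0" "w = \<rho> *\<^sub>R v" "B (y - x) v = 0"
proof -
  obtain z where z: "z \<in> plane x v" "z \<in> plane y w" "z \<noteq> 0"
    using m span_zero by blast
  obtain \<alpha> \<beta> where z1: "z = \<alpha> *\<^sub>R lift x + \<beta> *\<^sub>R dir_lift x v"
    using z(1) by (auto simp: span_insert span_singleton algebra_simps)
  obtain \<gamma> \<delta> where z2: "z = \<gamma> *\<^sub>R lift y + \<delta> *\<^sub>R dir_lift y w"
    using z(2) by (auto simp: span_insert span_singleton algebra_simps)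
  have q: "B \<qq> z = - \<alpha>" "B \<qq> z = - \<gamma>"
    using a by (simp add: z1 B_simps lift_products dir_lift_products,
      simp add: z2 B_simps lift_products dir_lift_products)
  then have \<gamma>: "\<gamma> = \<alpha>" by simp
  have p: "affine_proj B \<oo> \<qq> z = \<alpha> *\<^sub>R x + \<beta> *\<^sub>R v"
    using a by (simp add: z1 proj_eq B_simps lift_products dir_lift_products)
      (simp add: cone_lift_def dir_lift_def algebra_simps)
  have p': "affine_proj B \<oo> \<qq> z = \<alpha> *\<^sub>R y + \<delta> *\<^sub>R w"
    using a by (simp add: z2 \<gamma> proj_eq B_simps lift_products dir_lift_products)
      (simp add: cone_lift_def dir_lift_def algebra_simps)
  show thesis
  proof (cases "\<alpha> = 0")
    case False
    have "(1 / \<alpha>) *\<^sub>R (\<alpha> *\<^sub>R x + \<beta> *\<^sub>R v) = (1 / \<alpha>) *\<^sub>R (\<alpha> *\<^sub>R y + \<delta> *\<^sub>R w)"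
      using p p' by simp
    then have "x + (\<beta> / \<alpha>) *\<^sub>R v = y + (\<delta> / \<alpha>) *\<^sub>R w"
      using False by (simp add: scaleR_add_right)
    then show thesis by (rule that(1))
  next
    case True
    have nz: "\<beta> \<noteq> 0" using z(3) True by (auto simp: z1)
    have vw: "\<beta> *\<^sub>R v = \<delta> *\<^sub>R w" using p p' True by simp
    then have dz: "\<delta> \<noteq> 0" using nz a(3) by auto
    have "(1 / \<delta>) *\<^sub>R (\<beta> *\<^sub>R v) = w" by (simp add: vw dz)
    then have w: "w = (\<beta> / \<delta>) *\<^sub>R v" by simp
    have "B z \<oo> = - \<beta> * B x v" "B z \<oo> = - \<delta> * B y w"
      using a by (simp add: z1 True B_simps dir_lift_products,
         simp add: z2 \<gamma> True B_simps dir_lift_products)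
    then have "\<beta> * B x v = \<beta> * B y v" using dz by (auto simp: w B_simps)
    then have "B (y - x) v = 0" using nz by (simp add: B_simps)
    then show thesis using that(2)[of "\<beta> / \<delta>"] w nz dz by simp
  qed
qed

text \<open>The equation for \<open>x'\<close> supplies the second crossing point, or the second pair of parallel lines,
  from the coefficients of the given bivector.\<close>
lemma dual_edge_exists:
  assumes a: "x \<in> aff" "y \<in> aff" "null_dir v" "null_dir w"
    and m: "plane x v \<inter> plane y w \<noteq> {0}"
    and d: "dim (sum_space (plane x v) (plane y w)) = 3"
    and \<omega>: "\<omega> \<in> ext_square (sum_space (plane x v) (plane y w))"
      "biv_wedge_space \<omega> (plane x v \<inter> plane y w) \<noteq> {0}"
    and x': "y' - x' = affine_proj B \<oo> \<qq> (biv_act B \<omega> \<qq>)"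
  shows "\<exists>\<omega>'. dual_edge x v x' y w y' \<omega> \<omega>'"
  using a m
proof (cases rule: planes_meet_cases)
  case (1 r s)
  note pl = crossing_planes[OF 1 a(3,4)]
  have d': "dim (sum_space (span {lift (x + r *\<^sub>R v), dir_lift x v}) (span {lift (x + r *\<^sub>R v), dir_lift y w})) = 3"
    using d pl by simp
  obtain \<alpha> \<beta> c where w: "\<omega> = \<alpha> *\<^sub>R wedge2 (lift (x + r *\<^sub>R v)) (dir_lift x v)
      + \<beta> *\<^sub>R wedge2 (lift (x + r *\<^sub>R v)) (dir_lift y w) + c *\<^sub>R wedge2 (dir_lift x v) (dir_lift y w)"
    using \<omega>(1) unfolding pl meeting_planes(1)[OF d'] by (rule ext_square_span3)
  have c: "c \<noteq> 0" using biv_wedge_space_line[OF w d'] \<omega>(2) pl by simp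
  have X: "x + r *\<^sub>R v \<in> aff" using a by auto
  have "y' - x' = - (\<alpha> *\<^sub>R v + \<beta> *\<^sub>R w)"
    using a X unfolding x' w
    by (simp add: linear_add[OF linear_biv_act] linear_scale[OF linear_biv_act] biv_act_wedge2[OF bil]
        proj_eq B_simps lift_products dir_lift_products)
      (simp add: dir_lift_def B_simps algebra_simps)
  then have "x' + (- \<alpha>) *\<^sub>R v = y' + \<beta> *\<^sub>R w" by (simp add: algebra_simps)
  then have "crossing_dual x v x' y w y' \<omega> (wedge2 (lift (x' + (- \<alpha>) *\<^sub>R v)) ((- r) *\<^sub>R dir_lift x' v + s *\<^sub>R dir_lift y' w)
         + c *\<^sub>R wedge2 (dir_lift x' v) (dir_lift y' w))"
    unfolding crossing_dual_def crossing_form_def using 1 c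
    by (intro exI[of _ r] exI[of _ s] exI[of _ "- \<alpha>"] exI[of _ \<beta>] exI[of _ c])
      (simp add: w wedge2_simps)
  then show ?thesis unfolding dual_edge_def by blast
next
  case (2 \<rho>)
  note pl = parallel_planes[OF 2(2,1,3)]
  have d': "dim (sum_space (span {dir_lift x v, lift x}) (span {dir_lift x v, lift y})) = 3"
    using d pl by simp
  obtain \<alpha> \<beta> c where w: "\<omega> = \<alpha> *\<^sub>R wedge2 (dir_lift x v) (lift x)
      + \<beta> *\<^sub>R wedge2 (dir_lift x v) (lift y) + c *\<^sub>R wedge2 (lift x) (lift y)"
    using \<omega>(1) unfolding pl meeting_planes(1)[OF d'] by (rule ext_square_span3)
  have c: "c \<noteq> 0" using biv_wedge_space_line[OF w d'] \<omega>(2) pl by simp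
  have w': "\<omega> = (- \<alpha>) *\<^sub>R wedge2 (lift x) (dir_lift x v) + (- \<beta>) *\<^sub>R wedge2 (lift y) (dir_lift x v)
      + c *\<^sub>R wedge2 (lift x) (lift y)"
    unfolding w by (simp add: wedge2_swap[of "dir_lift x v"])
  have e: "y' - x' = - (((- \<alpha>) + (- \<beta>)) *\<^sub>R v + c *\<^sub>R (y - x))"
    using a 2(3) unfolding x' w
    by (simp add: linear_add[OF linear_biv_act] linear_scale[OF linear_biv_act] biv_act_wedge2[OF bil]
        proj_eq B_simps lift_products dir_lift_products)
      (simp add: cone_lift_def dir_lift_def B_simps algebra_simps)
  then have perp: "B (y' - x') v = 0" using 2(3) a by (simp add: B_simps)
  have "parallel_dual x v x' y w y' \<omega> ((- \<beta> / c) *\<^sub>R wedge2 (lift x') (dir_lift x' v)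
      + (- \<alpha> / c) *\<^sub>R wedge2 (lift y') (dir_lift x' v) + (1 / c) *\<^sub>R wedge2 (lift x') (lift y'))"
    unfolding parallel_dual_def parallel_form_def using 2 c w' e perp
    by (intro exI[of _ \<rho>] exI[of _ "- \<alpha>"] exI[of _ "- \<beta>"] exI[of _ c] conjI) simp_all
  then show ?thesis unfolding dual_edge_def by blast
qed

lemma dual_edge_flip:
  assumes "dual_edge x v x' y w y' \<omega> \<omega>'" "null_dir v" "null_dir w"
  shows "dual_edge y w y' x v x' (- \<omega>) (- \<omega>')"
proof -
  have "crossing_dual y w y' x v x' (- \<omega>) (- \<omega>')" if "crossing_dual x v x' y w y' \<omega> \<omega>'"
  proof -
    obtain r s r' s' c where *: "c \<noteq> 0" "crossing_form x v y w r s (- r') s' c \<omega>"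
      "crossing_form x' v y' w r' s' (- r) s c \<omega>'"
      using \<open>crossing_dual x v x' y w y' \<omega> \<omega>'\<close> unfolding crossing_dual_def by blast
    have flip: "crossing_form y w x v s r (- \<beta>) (- \<alpha>) c (- \<tau>)"
      if "crossing_form x v y w r s \<alpha> \<beta> c \<tau>" for x y r s \<alpha> \<beta> \<tau>
      using that unfolding crossing_form_def
      by (simp add: wedge2_simps wedge2_swap[of "dir_lift x v" "dir_lift y w"] algebra_simps)
    show ?thesis unfolding crossing_dual_def
      using flip[OF *(2)] flip[OF *(3)] *(1)
      by (intro exI[of _ s] exI[of _ r] exI[of _ s'] exI[of _ r'] exI[of _ c]) simp
  qed
  moreover have "parallel_dual y w y' x v x' (- \<omega>) (- \<omega>')" if pd: "parallel_dual x v x' y w y' \<omega> \<omega>'"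
  proof -
    obtain \<rho> \<alpha> \<beta> c where *: "\<rho> \<noteq> 0" "w = \<rho> *\<^sub>R v" "c \<noteq> 0"
      "y' - x' = - ((\<alpha> + \<beta>) *\<^sub>R v + c *\<^sub>R (y - x))"
      "parallel_form x v y \<alpha> \<beta> c \<omega>" "parallel_form x' v y' (\<beta> / c) (\<alpha> / c) (1 / c) \<omega>'"
      using pd unfolding parallel_dual_def by blast
    have flip: "parallel_form y w x (- \<beta> / \<rho>) (- \<alpha> / \<rho>) \<gamma> (- \<tau>)"
      if pf: "parallel_form x v y \<alpha> \<beta> \<gamma> \<tau>" for x y \<alpha> \<beta> \<gamma> \<tau>
    proof -
      have perp: "B (y - x) v = 0" using pf by (simp add: parallel_form_def)
      have "dir_lift y w = \<rho> *\<^sub>R dir_lift x v"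
        unfolding *(2) dir_lift_scale dir_lift_perp_shift[OF perp] ..
      moreover have "B (x - y) w = 0" using perp by (simp add: *(2) B_simps)
      ultimately show ?thesis using pf *(1) unfolding parallel_form_def
        by (simp add: wedge2_simps wedge2_swap[of "lift y" "lift x"])
    qed
    have "x' - y' = (\<alpha> + \<beta>) *\<^sub>R v + c *\<^sub>R (y - x)"
      using arg_cong[OF *(4), of uminus] by simp
    then have "x' - y' = - ((- \<beta> / \<rho> + - \<alpha> / \<rho>) *\<^sub>R w + c *\<^sub>R (x - y))"
      using *(1) by (simp add: *(2) algebra_simps)
    moreover have "v = (1 / \<rho>) *\<^sub>R w" using * by simp
    ultimately show ?thesis unfolding parallel_dual_def
      using flip[OF *(5)] flip[OF *(6)] *(1,3)
      by (intro exI[of _ "1 / \<rho>"] exI[of _ "- \<beta> / \<rho>"] exI[of _ "- \<alpha> / \<rho>"] exI[of _ c] conjI)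
        (simp_all add: field_simps)
  qed
  ultimately show ?thesis using assms(1) unfolding dual_edge_def by blast
qed

lemma dual_edge_planes_meet:
  assumes "dual_edge x v x' y w y' \<omega> \<omega>'" "x' \<in> aff" "null_dir v" "null_dir w"
  shows "plane x' v \<inter> plane y' w \<noteq> {0}"
  using assms(1) unfolding dual_edge_def
proof
  assume "crossing_dual x v x' y w y' \<omega> \<omega>'"
  then obtain r' s' where e: "x' + r' *\<^sub>R v = y' + s' *\<^sub>R w"
    unfolding crossing_dual_def crossing_form_def by blast
  have "x' + r' *\<^sub>R v \<in> aff" using assms by auto
  then have "lift (x' + r' *\<^sub>R v) \<noteq> 0" using lift_products(1) by (force simp: B_simps)
  moreover have "lift (x' + r' *\<^sub>R v) \<in> plane x' v \<inter> plane y' w"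
    unfolding crossing_planes[OF e assms(3,4)] by (simp add: span_base)
  ultimately show ?thesis by blast
next
  assume "parallel_dual x v x' y w y' \<omega> \<omega>'"
  then obtain \<rho> where e: "w = \<rho> *\<^sub>R v" "\<rho> \<noteq> 0" "B (y' - x') v = 0"
    unfolding parallel_dual_def parallel_form_def by blast
  have "dir_lift x' v \<in> plane x' v \<inter> plane y' w"
    unfolding parallel_planes[OF e] by (simp add: span_base)
  then show ?thesis using dir_lift_nonzero[OF assms(3)] by blast
qed

text \<open>The coefficient \<open>c\<close>, or \<open>1 / c\<close> for parallel lines, is non-zero and governs nondegeneracy by
  \<open>biv_wedge_space_line\<close>.\<close>
lemma dual_edge_applicable:
  assumes "dual_edge x v x' y w y' \<omega> \<omega>'" "null_dir v" "null_dir w"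
    and d: "dim (sum_space (plane x' v) (plane y' w)) = 3"
  shows "\<omega>' \<in> ext_square (sum_space (plane x' v) (plane y' w))"
    and "biv_wedge_space \<omega>' (plane x' v \<inter> plane y' w) \<noteq> {0}"
proof -
  have gen: "\<omega>' \<in> ext_square (sum_space (plane x' v) (plane y' w)) \<and>
      biv_wedge_space \<omega>' (plane x' v \<inter> plane y' w) \<noteq> {0}" if pl: "plane x' v = span {a, b}" "plane y' w = span {a, e}"
    and w: "\<omega>' = \<alpha> *\<^sub>R wedge2 a b + \<beta> *\<^sub>R wedge2 a e + \<gamma> *\<^sub>R wedge2 b e" and g: "\<gamma> \<noteq> 0" for a b e \<alpha> \<beta> \<gamma>
  proof -
    have d': "dim (sum_space (span {a, b}) (span {a, e})) = 3" using d pl by simp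
    have "\<omega>' \<in> ext_square (span {a, b, e})" unfolding w
      by (intro subspace_add subspace_scale subspace_ext_square ext_square_base span_base) auto
    then show ?thesis
      unfolding pl meeting_planes(1)[OF d'] biv_wedge_space_line[OF w d'] using g by blast
  qed
  have "\<omega>' \<in> ext_square (sum_space (plane x' v) (plane y' w)) \<and>
     biv_wedge_space \<omega>' (plane x' v \<inter> plane y' w) \<noteq> {0}"
    using assms(1) unfolding dual_edge_def
  proof
    assume "crossing_dual x v x' y w y' \<omega> \<omega>'"
    then obtain r s r' s' c where c: "c \<noteq> 0" and f: "crossing_form x' v y' w r' s' (- r) s c \<omega>'"
      unfolding crossing_dual_def by blast
    then have e: "x' + r' *\<^sub>R v = y' + s' *\<^sub>R w" and
      w: "\<omega>' = (- r) *\<^sub>R wedge2 (lift (x' + r' *\<^sub>R v)) (dir_lift x' v)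
        + s *\<^sub>R wedge2 (lift (x' + r' *\<^sub>R v)) (dir_lift y' w) + c *\<^sub>R wedge2 (dir_lift x' v) (dir_lift y' w)"
      by (simp_all add: crossing_form_def wedge2_simps)
    show ?thesis using gen[OF crossing_planes[OF e assms(2,3)] w c] by blast
  next
    assume "parallel_dual x v x' y w y' \<omega> \<omega>'"
    then obtain \<rho> \<alpha> \<beta> c where *: "w = \<rho> *\<^sub>R v" "\<rho> \<noteq> 0" "c \<noteq> 0"
      and f: "parallel_form x' v y' (\<beta> / c) (\<alpha> / c) (1 / c) \<omega>'"
      unfolding parallel_dual_def by blast
    have e: "B (y' - x') v = 0" using f by (simp add: parallel_form_def)
    have w: "\<omega>' = (- (\<beta> / c)) *\<^sub>R wedge2 (dir_lift x' v) (lift x') +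
        (- (\<alpha> / c)) *\<^sub>R wedge2 (dir_lift x' v) (lift y') + (1 / c) *\<^sub>R wedge2 (lift x') (lift y')"
      using f by (simp add: parallel_form_def wedge2_swap[of "dir_lift x' v"])
    have "1 / c \<noteq> 0" using *(3) by simp
    then show ?thesis using gen[OF parallel_planes[OF *(1,2) e] w] by blast
  qed
  then show "\<omega>' \<in> ext_square (sum_space (plane x' v) (plane y' w))"
    "biv_wedge_space \<omega>' (plane x' v \<inter> plane y' w) \<noteq> {0}" by auto
qed

lemma plane_null:
  assumes "x \<in> aff" "null_dir v" "y \<in> plane x v" "z \<in> plane x v"
  shows "B y z = 0"
proof -
  obtain \<alpha> \<beta> where y: "y = \<alpha> *\<^sub>R lift x + \<beta> *\<^sub>R dir_lift x v"
    using assms(3) by (auto simp: span_insert span_singleton algebra_simps)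
  obtain \<gamma> \<delta> where z: "z = \<gamma> *\<^sub>R lift x + \<delta> *\<^sub>R dir_lift x v"
    using assms(4) by (auto simp: span_insert span_singleton algebra_simps)
  show ?thesis using assms(1,2) by (simp add: y z B_simps lift_products dir_lift_products)
qed

lemma dim_plane:
  assumes "x \<in> aff" "null_dir v"
  shows "dim (plane x v) = 2"
proof -
  have n: "lift x \<notin> span {dir_lift x v}"
  proof
    assume "lift x \<in> span {dir_lift x v}"
    then obtain r where "lift x = r *\<^sub>R dir_lift x v" by (auto simp: span_singleton)
    then have "B \<qq> (lift x) = r * B \<qq> (dir_lift x v)" by (simp add: B_simps)
    then show False using assms by (simp add: lift_products dir_lift_products)
  qed
  then have "independent {lift x, dir_lift x v}" "lift x \<noteq> dir_lift x v"
    using dir_lift_nonzero[OF assms(2)] by (auto simp: independent_insert span_base)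
  then show ?thesis using dim_eq_card_independent by fastforce
qed

lemma crossing_meet:
  assumes "x + r *\<^sub>R v = y + s *\<^sub>R w" "null_dir v" "null_dir w"
    and "dim (sum_space (plane x v) (plane y w)) = 3"
  shows "plane x v \<inter> plane y w = span {lift (x + r *\<^sub>R v)}"
  using meeting_planes(2) crossing_planes[OF assms(1-3)] assms(4) by metis

text \<open>The meeting line is spanned by the lift of a point or of a direction, and \<open>\<qq>\<close> tells these apart.\<close>
lemma dual_edge_meet:
  assumes "dual_edge x v x' y w y' \<omega> \<omega>'" "x' \<in> aff" "null_dir v" "null_dir w"
    and "dim (sum_space (plane x' v) (plane y' w)) = 3"
  obtains \<sigma> where "plane x' v \<inter> plane y' w = span {\<sigma>}"
    "B \<qq> \<sigma> \<noteq> 0 \<longrightarrow> crossing_dual x v x' y w y' \<omega> \<omega>' \<and> B \<qq> \<sigma> = -1"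
proof -
  consider "crossing_dual x v x' y w y' \<omega> \<omega>'" | "parallel_dual x v x' y w y' \<omega> \<omega>'"
    using assms(1) unfolding dual_edge_def by blast
  then show thesis
  proof cases
    case 1
    then obtain r' s' where e: "x' + r' *\<^sub>R v = y' + s' *\<^sub>R w"
      unfolding crossing_dual_def crossing_form_def by blast
    have "x' + r' *\<^sub>R v \<in> aff" using assms by auto
    then show thesis using that[OF crossing_meet[OF e assms(3-5)]] 1 by (simp add: lift_products)
  next
    case 2
    then obtain \<rho> where e: "w = \<rho> *\<^sub>R v" "\<rho> \<noteq> 0" "B (y' - x') v = 0"
      unfolding parallel_dual_def parallel_form_def by blast
    have "plane x' v \<inter> plane y' w = span {dir_lift x' v}"
      using meeting_planes(2) parallel_planes[OF e] assms(5) by metis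
    then show thesis using assms(3) by (intro that[of "dir_lift x' v"]) (simp_all add: dir_lift_products)
  qed
qed

section \<open>Closedness of the dual form on a quadrilateral\<close>

text \<open>Let \<open>A, b, C, d\<close> be the lifts of the four crossing points. Each is null and orthogonal to its
  neighbours, so the terms containing one of them as a factor, and the forms over the two edges at
  \<open>b\<close> and \<open>d\<close>, pair to zero. The two remaining terms are evaluated by writing \<open>b\<close> and \<open>d\<close> as
  translates of \<open>A\<close> and of \<open>C\<close> along the lines. The two resulting expressions for \<open>(b, d)\<close> make
  the outcome symmetric in the two pairs of lines.\<close>
lemma crossing_quad_pairing:
  assumes a: "x1 \<in> aff" "x2 \<in> aff" "x3 \<in> aff" "x4 \<in> aff"
    and n: "null_dir v1" "null_dir v2" "null_dir v3" "null_dir v4"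
    and f12: "crossing_form x1 v1 x2 v2 r1 s1 \<alpha>1 \<beta>1 c1 \<omega>1"
    and f23: "crossing_form x2 v2 x3 v3 r2 s2 \<alpha>2 \<beta>2 c2 \<omega>2"
    and f34: "crossing_form x3 v3 x4 v4 r3 s3 \<alpha>3 \<beta>3 c3 \<omega>3"
    and f41: "crossing_form x4 v4 x1 v1 r4 s4 \<alpha>4 \<beta>4 c4 \<omega>4"
  shows "pairing (\<omega>1 + \<omega>2 + \<omega>3 + \<omega>4) (lift (x2 + r2 *\<^sub>R v2)) (lift (x4 + r4 *\<^sub>R v4)) =
      B (lift (x2 + r2 *\<^sub>R v2)) (lift (x4 + r4 *\<^sub>R v4)) * (c1 * B v1 v2 - c3 * B v3 v4)"
    and "B v1 v2 = 0 \<Longrightarrow> B (lift (x2 + r2 *\<^sub>R v2)) (lift (x4 + r4 *\<^sub>R v4)) = 0"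
    and "lift (x2 + r2 *\<^sub>R v2) \<noteq> lift (x1 + r1 *\<^sub>R v1) \<Longrightarrow> lift (x1 + r1 *\<^sub>R v1) \<noteq> lift (x4 + r4 *\<^sub>R v4)
      \<Longrightarrow> B v1 v2 \<noteq> 0 \<Longrightarrow> B (lift (x2 + r2 *\<^sub>R v2)) (lift (x4 + r4 *\<^sub>R v4)) \<noteq> 0"
proof -
  define A where "A = lift (x1 + r1 *\<^sub>R v1)"
  define b where "b = lift (x2 + r2 *\<^sub>R v2)"
  define C where "C = lift (x3 + r3 *\<^sub>R v3)"
  define d where "d = lift (x4 + r4 *\<^sub>R v4)"
  define V1 where "V1 = dir_lift x1 v1"
  define V2 where "V2 = dir_lift x2 v2"
  define V3 where "V3 = dir_lift x3 v3"
  define V4 where "V4 = dir_lift x4 v4"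
  have A: "A = lift x1 + r1 *\<^sub>R V1" "A = lift x2 + s1 *\<^sub>R V2"
    using f12 n by (simp_all add: A_def V1_def V2_def crossing_form_def flip: lift_shift)
  have b: "b = lift x2 + r2 *\<^sub>R V2" "b = lift x3 + s2 *\<^sub>R V3"
    using f23 n by (simp_all add: b_def V2_def V3_def crossing_form_def flip: lift_shift)
  have C: "C = lift x3 + r3 *\<^sub>R V3" "C = lift x4 + s3 *\<^sub>R V4"
    using f34 n by (simp_all add: C_def V3_def V4_def crossing_form_def flip: lift_shift)
  have d: "d = lift x4 + r4 *\<^sub>R V4" "d = lift x1 + s4 *\<^sub>R V1"
    using f41 n by (simp_all add: d_def V4_def V1_def crossing_form_def flip: lift_shift)
  have bA: "b = A + (r2 - s1) *\<^sub>R V2" unfolding A(2) b(1) by (simp add: algebra_simps)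
  have dA: "d = A + (s4 - r1) *\<^sub>R V1" unfolding A(1) d(2) by (simp add: algebra_simps)
  have bC: "b = C + (s2 - r3) *\<^sub>R V3" unfolding C(1) b(2) by (simp add: algebra_simps)
  have dC: "d = C + (r4 - s3) *\<^sub>R V4" unfolding C(2) d(1) by (simp add: algebra_simps)
  have g: "B V1 V1 = 0" "B V2 V2 = 0" "B V3 V3 = 0" "B V4 V4 = 0" "B V1 V2 = B v1 v2" "B V2 V1 = B v1 v2"
    "B V3 V4 = B v3 v4" "B V4 V3 = B v3 v4"
    using n by (simp_all add: V1_def V2_def V3_def V4_def dir_lift_products sym[of v2 v1] sym[of v4 v3])
  have l: "B (lift x1) V1 = 0" "B (lift x2) V2 = 0" "B (lift x3) V3 = 0" "B (lift x4) V4 = 0"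
    using a n by (simp_all add: V1_def V2_def V3_def V4_def dir_lift_products)
  have p: "B A V1 = 0" "B A V2 = 0" "B b V2 = 0" "B b V3 = 0"
     "B C V3 = 0" "B C V4 = 0" "B d V4 = 0" "B d V1 = 0"
    using l g by (simp add: A(1) B_simps, simp add: A(2) B_simps, simp add: b(1) B_simps,
      simp add: b(2) B_simps, simp add: C(1) B_simps, simp add: C(2) B_simps,
      simp add: d(1) B_simps, simp add: d(2) B_simps)
  have p': "B V1 A = 0" "B V2 A = 0" "B V2 b = 0" "B V3 b = 0"
     "B V3 C = 0" "B V4 C = 0" "B V4 d = 0" "B V1 d = 0"
    using p sym by metis+
  have aff: "x1 + r1 *\<^sub>R v1 \<in> aff" "x2 + r2 *\<^sub>R v2 \<in> aff" "x3 + r3 *\<^sub>R v3 \<in> aff" "x4 + r4 *\<^sub>R v4 \<in> aff"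
    using a n by auto
  have N: "B A A = 0" "B b b = 0" "B C C = 0" "B d d = 0"
    using aff by (simp_all add: A_def b_def C_def d_def lift_products)
  have o: "B A b = 0" "B A d = 0" "B C b = 0" "B C d = 0"
    using N p by (simp add: bA B_simps, simp add: dA B_simps, simp add: bC B_simps, simp add: dC B_simps)
  have V: "B V1 b = (r2 - s1) * B v1 v2" "B V2 d = (s4 - r1) * B v1 v2"
      "B V3 d = (r4 - s3) * B v3 v4" "B V4 b = (s2 - r3) * B v3 v4"
    using p' g by (simp add: bA B_simps, simp add: dA B_simps, simp add: dC B_simps, simp add: bC B_simps)
  have bd: "B b d = (r2 - s1) * ((s4 - r1) * B v1 v2)"
  proof -
    have "B b d = B A d + (r2 - s1) * B V2 d" by (subst bA) (simp add: B_simps)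
    then show ?thesis by (simp add: o V)
  qed
  have bd': "B b d = (s2 - r3) * ((r4 - s3) * B v3 v4)"
  proof -
    have "B b d = B C d + (s2 - r3) * B V3 d" by (subst bC) (simp add: B_simps)
    then show ?thesis by (simp add: o V)
  qed
  have "pairing \<omega>1 b d = c1 * ((r2 - s1) * B v1 v2 * ((s4 - r1) * B v1 v2))"
    using f12 unfolding crossing_form_def A_def[symmetric] V1_def[symmetric] V2_def[symmetric]
    by (simp add: pairing_simps B_simps o V p')
  then have w1: "pairing \<omega>1 b d = B b d * (c1 * B v1 v2)" by (simp add: bd)
  have w2: "pairing \<omega>2 b d = 0"
    using f23 unfolding crossing_form_def b_def[symmetric] V2_def[symmetric] V3_def[symmetric]
    by (simp add: pairing_simps B_simps N p')
  have "pairing \<omega>3 b d = - (c3 * ((s2 - r3) * B v3 v4 * ((r4 - s3) * B v3 v4)))"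
    using f34 unfolding crossing_form_def C_def[symmetric] V3_def[symmetric] V4_def[symmetric]
    by (simp add: pairing_simps B_simps o V p')
  then have w3: "pairing \<omega>3 b d = - (B b d * (c3 * B v3 v4))" by (simp add: bd')
  have w4: "pairing \<omega>4 b d = 0"
    using f41 unfolding crossing_form_def d_def[symmetric] V4_def[symmetric] V1_def[symmetric]
    by (simp add: pairing_simps B_simps N p')
  show "pairing (\<omega>1 + \<omega>2 + \<omega>3 + \<omega>4) (lift (x2 + r2 *\<^sub>R v2)) (lift (x4 + r4 *\<^sub>R v4)) =
      B (lift (x2 + r2 *\<^sub>R v2)) (lift (x4 + r4 *\<^sub>R v4)) * (c1 * B v1 v2 - c3 * B v3 v4)"
    unfolding b_def[symmetric] d_def[symmetric] pairing_simps w1 w2 w3 w4 by (simp add: algebra_simps)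
  show "B v1 v2 = 0 \<Longrightarrow> B (lift (x2 + r2 *\<^sub>R v2)) (lift (x4 + r4 *\<^sub>R v4)) = 0"
    unfolding b_def[symmetric] d_def[symmetric] bd by simp
  assume "lift (x2 + r2 *\<^sub>R v2) \<noteq> lift (x1 + r1 *\<^sub>R v1)" "lift (x1 + r1 *\<^sub>R v1) \<noteq> lift (x4 + r4 *\<^sub>R v4)"
    and vv: "B v1 v2 \<noteq> 0"
  then have "b \<noteq> A" "A \<noteq> d" unfolding A_def b_def d_def by simp_all
  then have "r2 - s1 \<noteq> 0" "s4 - r1 \<noteq> 0" using bA dA by (metis add.right_neutral scale_zero_left)+
  then show "B (lift (x2 + r2 *\<^sub>R v2)) (lift (x4 + r4 *\<^sub>R v4)) \<noteq> 0"
    unfolding b_def[symmetric] d_def[symmetric] bd using vv by simp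
qed

text \<open>Only the products \<open>(a, c)\<close> and \<open>(b, d)\<close> can be non-zero, so the pairings of \<open>\<qq>\<close> with \<open>a, b, c, d\<close>
  are \<open>\<gamma> (a, c), \<delta> (b, d), \<alpha> (a, c), \<beta> (b, d)\<close>, and \<open>\<qq>\<close> being null means
  \<open>\<alpha> \<gamma> (a, c) + \<beta> \<delta> (b, d) = 0\<close>. If one of the pairings vanished, so would one of these two products,
  hence both, and then two neighbouring pairings would vanish together.\<close>
lemma null_cycle:
  assumes q: "\<qq> = \<alpha> *\<^sub>R a + \<beta> *\<^sub>R b + \<gamma> *\<^sub>R c + \<delta> *\<^sub>R d"
    and n: "B a a = 0" "B b b = 0" "B c c = 0" "B d d = 0"
    and o: "B a b = 0" "B b c = 0" "B c d = 0" "B d a = 0"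
    and nq: "B \<qq> a \<noteq> 0 \<or> B \<qq> b \<noteq> 0" "B \<qq> b \<noteq> 0 \<or> B \<qq> c \<noteq> 0" "B \<qq> c \<noteq> 0 \<or> B \<qq> d \<noteq> 0"
      "B \<qq> d \<noteq> 0 \<or> B \<qq> a \<noteq> 0"
  shows "B \<qq> a \<noteq> 0" "B \<qq> b \<noteq> 0" "B \<qq> c \<noteq> 0" "B \<qq> d \<noteq> 0" "B a c \<noteq> 0" "B b d \<noteq> 0"
proof -
  have qa: "B \<qq> a = \<gamma> * B a c" "B \<qq> b = \<delta> * B b d" "B \<qq> c = \<alpha> * B a c" "B \<qq> d = \<beta> * B b d"
    using sym[of b a] sym[of c b] sym[of d c] sym[of c a] sym[of d b] sym[of a d]
    by (simp_all add: q B_simps n o)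
  have "B \<qq> \<qq> = \<alpha> * B \<qq> a + \<beta> * B \<qq> b + \<gamma> * B \<qq> c + \<delta> * B \<qq> d"
    by (subst (2) q) (simp add: B_simps)
  then have "\<alpha> * \<gamma> * B a c + \<beta> * \<delta> * B b d = 0" by (simp add: qq qa algebra_simps)
  then show "B \<qq> a \<noteq> 0" "B \<qq> b \<noteq> 0" "B \<qq> c \<noteq> 0" "B \<qq> d \<noteq> 0" "B a c \<noteq> 0" "B b d \<noteq> 0"
    using nq unfolding qa by auto
qed

text \<open>With these normalisations \<open>\<qq>\<close> is a multiple of \<open>a - b + c - d\<close>, and the three conditions on \<open>Z\<close>
  equate its coefficients in the same pattern.\<close>
lemma null_cycle_radical:
  assumes q: "\<qq> = \<alpha> *\<^sub>R a + \<beta> *\<^sub>R b + \<gamma> *\<^sub>R c + \<delta> *\<^sub>R d"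
    and n: "B a a = 0" "B b b = 0" "B c c = 0" "B d d = 0"
    and o: "B a b = 0" "B b c = 0" "B c d = 0" "B d a = 0"
    and qn: "B \<qq> a = -1" "B \<qq> b = -1" "B \<qq> c = -1" "B \<qq> d = -1"
    and Z: "Z \<in> span {a, b, c, d}" "B \<qq> Z = 0" "B Z a = B Z c" "B Z b = B Z d"
  shows "wedge2 Z \<qq> = 0"
proof -
  obtain \<alpha>' \<beta>' \<gamma>' \<delta>' where z: "Z = \<alpha>' *\<^sub>R a + \<beta>' *\<^sub>R b + \<gamma>' *\<^sub>R c + \<delta>' *\<^sub>R d"
    using Z(1) by (auto simp: span_insert span_singleton algebra_simps)
  note s = sym[of b a] sym[of c b] sym[of d c] sym[of c a] sym[of d b] sym[of a d]
  have qa: "\<gamma> * B a c = -1" "\<delta> * B b d = -1" "\<alpha> * B a c = -1" "\<beta> * B b d = -1"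
    using qn s by (simp_all add: q B_simps n o)
  have za: "B Z a = \<gamma>' * B a c" "B Z b = \<delta>' * B b d" "B Z c = \<alpha>' * B a c" "B Z d = \<beta>' * B b d"
    using s by (simp_all add: z B_simps n o)
  have nz: "B a c \<noteq> 0" "B b d \<noteq> 0" using qa by auto
  have eq: "\<gamma> = \<alpha>" "\<delta> = \<beta>" "\<gamma>' = \<alpha>'" "\<delta>' = \<beta>'"
    using qa Z(3,4) nz by (metis mult_cancel_right, metis mult_cancel_right, simp add: za, simp add: za)
  have "B \<qq> \<qq> = - (\<alpha> + \<beta> + \<gamma> + \<delta>)"
    by (subst (2) q) (simp add: B_simps qn)
  then have ab: "\<beta> = - \<alpha>" by (simp add: qq eq)
  have "B \<qq> Z = - (\<alpha>' + \<beta>' + \<gamma>' + \<delta>')" by (simp add: z B_simps qn)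
  then have ab': "\<beta>' = - \<alpha>'" by (simp add: Z(2) eq)
  have "\<alpha> \<noteq> 0" using qa(3) by auto
  then have "Z = (\<alpha>' / \<alpha>) *\<^sub>R \<qq>" by (simp add: z q eq ab ab' algebra_simps)
  then show ?thesis by (simp add: wedge2_simps)
qed

text \<open>The bracket in \<open>crossing_quad_pairing\<close> involves only directions and the coefficients \<open>c\<close>, which
  both families share. The sum of the given form is zero and its corner product is not, because
  neighbouring crossing points differ; so the bracket vanishes.\<close>
lemma opposite_corner_pairing_of_dual:
  assumes a: "x1 \<in> aff" "x2 \<in> aff" "x3 \<in> aff" "x4 \<in> aff"
    and a': "x1' \<in> aff" "x2' \<in> aff" "x3' \<in> aff" "x4' \<in> aff"
    and n: "null_dir v1" "null_dir v2" "null_dir v3" "null_dir v4"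
    and f: "crossing_form x1 v1 x2 v2 r1 s1 \<alpha>1 \<beta>1 c1 \<omega>1" "crossing_form x2 v2 x3 v3 r2 s2 \<alpha>2 \<beta>2 c2 \<omega>2"
      "crossing_form x3 v3 x4 v4 r3 s3 \<alpha>3 \<beta>3 c3 \<omega>3" "crossing_form x4 v4 x1 v1 r4 s4 \<alpha>4 \<beta>4 c4 \<omega>4"
    and f': "crossing_form x1' v1 x2' v2 r1' s1' \<alpha>1' \<beta>1' c1 \<omega>1'" "crossing_form x2' v2 x3' v3 r2' s2' \<alpha>2' \<beta>2' c2 \<omega>2'"
      "crossing_form x3' v3 x4' v4 r3' s3' \<alpha>3' \<beta>3' c3 \<omega>3'" "crossing_form x4' v4 x1' v1 r4' s4' \<alpha>4' \<beta>4' c4 \<omega>4'"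
    and closed: "\<omega>1 + \<omega>2 + \<omega>3 + \<omega>4 = 0"
    and ne: "lift (x2 + r2 *\<^sub>R v2) \<noteq> lift (x1 + r1 *\<^sub>R v1)" "lift (x1 + r1 *\<^sub>R v1) \<noteq> lift (x4 + r4 *\<^sub>R v4)"
    and nz: "B (lift (x2' + r2' *\<^sub>R v2)) (lift (x4' + r4' *\<^sub>R v4)) \<noteq> 0"
  shows "pairing (\<omega>1' + \<omega>2' + \<omega>3' + \<omega>4') (lift (x2' + r2' *\<^sub>R v2)) (lift (x4' + r4' *\<^sub>R v4)) = 0"
proof -
  note q = crossing_quad_pairing[OF a n f] and q' = crossing_quad_pairing[OF a' n f']
  have "B v1 v2 \<noteq> 0" using q'(2) nz by blast
  then have "B (lift (x2 + r2 *\<^sub>R v2)) (lift (x4 + r4 *\<^sub>R v4)) \<noteq> 0" using q(3) ne by blast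
  then have "c1 * B v1 v2 - c3 * B v3 v4 = 0" using q(1) unfolding closed by (simp add: pairing_simps)
  then show ?thesis unfolding q'(1) by simp
qed

text \<open>Identifies a generator of a meeting line with the lift of the crossing point.\<close>
lemma span_normalised_unique:
  assumes "span {\<sigma>} = span {\<tau>}" "B \<qq> \<sigma> = -1" "B \<qq> \<tau> = -1"
  shows "\<sigma> = \<tau>"
proof -
  have "\<sigma> \<in> span {\<tau>}" using assms(1) span_base by blast
  then obtain r where r: "\<sigma> = r *\<^sub>R \<tau>" by (auto simp: span_singleton)
  then show ?thesis using assms(2,3) by (simp add: B_simps)
qed

text \<open>Closedness of the dual form: the sum is \<open>Z \<and> \<qq>\<close> by \<open>dual_pairings\<close>, and a non-zero value would put
  \<open>Z\<close> and \<open>\<qq>\<close> into the span of the four meeting lines, where the pairings with both pairs of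
  opposite corners rule it out.\<close>
lemma dual_closed_on_quad:
  fixes x v x' :: "'i \<Rightarrow> real^'n" and \<eta> h :: "'i \<Rightarrow> 'i \<Rightarrow> real^'n^'n"
  defines "P \<equiv> \<lambda>n. plane (x n) (v n)" and "P' \<equiv> \<lambda>n. plane (x' n) (v n)"
  assumes vert: "x i \<in> aff" "x j \<in> aff" "x k \<in> aff" "x l \<in> aff"
      "x' i \<in> aff" "x' j \<in> aff" "x' k \<in> aff" "x' l \<in> aff"
      "null_dir (v i)" "null_dir (v j)" "null_dir (v k)" "null_dir (v l)"
    and edge: "dual_edge (x i) (v i) (x' i) (x j) (v j) (x' j) (\<eta> j i) (h j i)"
      "dual_edge (x j) (v j) (x' j) (x k) (v k) (x' k) (\<eta> k j) (h k j)"
      "dual_edge (x k) (v k) (x' k) (x l) (v l) (x' l) (\<eta> l k) (h l k)"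
      "dual_edge (x l) (v l) (x' l) (x i) (v i) (x' i) (\<eta> i l) (h i l)"
    and dim: "dim (sum_space (P i) (P j)) = 3" "dim (sum_space (P j) (P k)) = 3"
      "dim (sum_space (P k) (P l)) = 3" "dim (sum_space (P l) (P i)) = 3"
    and dim': "dim (sum_space (P' i) (P' j)) = 3" "dim (sum_space (P' j) (P' k)) = 3"
      "dim (sum_space (P' k) (P' l)) = 3" "dim (sum_space (P' l) (P' i)) = 3"
    and reg: "wedge_spaces (P i \<inter> P j) (P j \<inter> P k) (P k \<inter> P l) (P l \<inter> P i) \<noteq> {0}"
    and reg': "wedge_spaces (P' i \<inter> P' j) (P' j \<inter> P' k) (P' k \<inter> P' l) (P' l \<inter> P' i) \<noteq> {0}"
    and closed: "\<eta> i l + \<eta> l k + \<eta> k j + \<eta> j i = 0"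
  shows "h i l + h l k + h k j + h j i = 0"
proof (rule ccontr)
  define E where "E = h j i + h k j + h l k + h i l"
  assume "h i l + h l k + h k j + h j i \<noteq> 0"
  then have E0: "E \<noteq> 0" by (simp add: E_def add_ac)
  obtain a where a: "P' i \<inter> P' j = span {a}"
    "B \<qq> a \<noteq> 0 \<longrightarrow> crossing_dual (x i) (v i) (x' i) (x j) (v j) (x' j) (\<eta> j i) (h j i) \<and> B \<qq> a = -1"
    unfolding P'_def using dual_edge_meet[OF edge(1) vert(5,9,10) dim'(1)[unfolded P'_def]] by blast
  obtain b where b: "P' j \<inter> P' k = span {b}"
    "B \<qq> b \<noteq> 0 \<longrightarrow> crossing_dual (x j) (v j) (x' j) (x k) (v k) (x' k) (\<eta> k j) (h k j) \<and> B \<qq> b = -1"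
    unfolding P'_def using dual_edge_meet[OF edge(2) vert(6,10,11) dim'(2)[unfolded P'_def]] by blast
  obtain c where c: "P' k \<inter> P' l = span {c}"
    "B \<qq> c \<noteq> 0 \<longrightarrow> crossing_dual (x k) (v k) (x' k) (x l) (v l) (x' l) (\<eta> l k) (h l k) \<and> B \<qq> c = -1"
    unfolding P'_def using dual_edge_meet[OF edge(3) vert(7,11,12) dim'(3)[unfolded P'_def]] by blast
  obtain d where d: "P' l \<inter> P' i = span {d}"
    "B \<qq> d \<noteq> 0 \<longrightarrow> crossing_dual (x l) (v l) (x' l) (x i) (v i) (x' i) (\<eta> i l) (h i l) \<and> B \<qq> d = -1"
    unfolding P'_def using dual_edge_meet[OF edge(4) vert(8,12,9) dim'(4)[unfolded P'_def]] by blast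
  have mem: "a \<in> P' i" "a \<in> P' j" "b \<in> P' j" "b \<in> P' k" "c \<in> P' k" "c \<in> P' l" "d \<in> P' l" "d \<in> P' i"
    using a(1) b(1) c(1) d(1) span_base[of _ "{_}"] by blast+
  note adj = wedge_spaces_nonzero_adjacent[OF reg'[unfolded a(1) b(1) c(1) d(1)]]
  have P'2: "subspace (P' n)" "x' n \<in> aff \<Longrightarrow> null_dir (v n) \<Longrightarrow> dim (P' n) = 2" for n
    unfolding P'_def by (simp_all add: dim_plane del: dim_span)
  \<comment> \<open>Each plane contains the meeting lines of its two edges, which are distinct by regularity.\<close>
  have spans: "P' i = span {d, a}" "P' j = span {a, b}" "P' k = span {b, c}" "P' l = span {c, d}"
    using adj mem span_two_eq[OF P'2(1) P'2(2)[OF vert(5,9)], of d a]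
      span_two_eq[OF P'2(1) P'2(2)[OF vert(6,10)], of a b] span_two_eq[OF P'2(1) P'2(2)[OF vert(7,11)], of b c]
      span_two_eq[OF P'2(1) P'2(2)[OF vert(8,12)], of c d] by blast+
  have null: "B a a = 0" "B b b = 0" "B c c = 0" "B d d = 0" "B a b = 0" "B b c = 0" "B c d = 0" "B d a = 0"
    using mem vert plane_null unfolding P'_def by blast+
  let ?F = "span {a, b, c, d}"
  have sub: "sum_space (P' i) (P' j) \<subseteq> ?F" "sum_space (P' j) (P' k) \<subseteq> ?F"
     "sum_space (P' k) (P' l) \<subseteq> ?F" "sum_space (P' l) (P' i) \<subseteq> ?F"
  proof -
    have "P' n \<subseteq> ?F" if "n \<in> {i, j, k, l}" for n
      using that spans span_mono[of "{d, a}" "{a, b, c, d}"] span_mono[of "{a, b}" "{a, b, c, d}"]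
        span_mono[of "{b, c}" "{a, b, c, d}"] span_mono[of "{c, d}" "{a, b, c, d}"] by auto
    then have "sum_space (P' m) (P' n) \<subseteq> ?F" if "m \<in> {i, j, k, l}" "n \<in> {i, j, k, l}" for m n
      using that unfolding sum_space_def by (blast intro: span_add)
    then show "sum_space (P' i) (P' j) \<subseteq> ?F" "sum_space (P' j) (P' k) \<subseteq> ?F"
     "sum_space (P' k) (P' l) \<subseteq> ?F" "sum_space (P' l) (P' i) \<subseteq> ?F" by blast+
  qed
  have "h j i \<in> ext_square ?F" "h k j \<in> ext_square ?F" "h l k \<in> ext_square ?F" "h i l \<in> ext_square ?F"
    using dual_edge_applicable(1)[OF edge(1) vert(9,10) dim'(1)[unfolded P'_def]]
      dual_edge_applicable(1)[OF edge(2) vert(10,11) dim'(2)[unfolded P'_def]]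
      dual_edge_applicable(1)[OF edge(3) vert(11,12) dim'(3)[unfolded P'_def]]
      dual_edge_applicable(1)[OF edge(4) vert(12,9) dim'(4)[unfolded P'_def]]
      sub[THEN ext_square_mono] unfolding P'_def by blast+
  then have EF: "E \<in> ext_square ?F"
    unfolding E_def by (intro subspace_add[OF subspace_ext_square])
  note p1 = dual_pairings[OF edge(1) vert(1,5,2,6,9,10)] and p2 = dual_pairings[OF edge(2) vert(2,6,3,7,10,11)]
    and p3 = dual_pairings[OF edge(3) vert(3,7,4,8,11,12)] and p4 = dual_pairings[OF edge(4) vert(4,8,1,5,12,9)]
  have H: "\<eta> j i + \<eta> k j + \<eta> l k + \<eta> i l = 0" using closed by (simp add: add_ac)
  have H0: "pairing (\<eta> j i) y z + pairing (\<eta> k j) y z + pairing (\<eta> l k) y z + pairing (\<eta> i l) y z = 0" for y z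
    using arg_cong[OF H, of "\<lambda>\<omega>. pairing \<omega> y z"] by (simp add: pairing_simps)
  have "pairing E u z = 0" if "u \<in> aff" "z \<in> aff" for u z
    using H0[of u z] by (simp add: E_def pairing_simps(2) p1(1)[OF that] p2(1)[OF that] p3(1)[OF that] p4(1)[OF that])
      (simp add: pairing_simps)
  moreover have "pairing E \<qq> z = 0" if "z \<in> aff" for z
    by (simp add: E_def pairing_simps(2) p1(2)[OF that] p2(2)[OF that] p3(2)[OF that] p4(2)[OF that] B_simps)
  moreover have "pairing E \<oo> \<qq> = 0"
    using H0[of \<oo> \<qq>] by (simp add: E_def pairing_simps(2) p1(3) p2(3) p3(3) p4(3))
  ultimately obtain Z where Z: "E = wedge2 Z \<qq>" "B \<qq> Z = 0"
    using eq_wedge_q_of_pairings[OF EF] by blast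
  have ZF: "Z \<in> ?F" and qF: "\<qq> \<in> ?F"
    using wedge2_in_ext_square_factors[OF subspace_span] EF E0 unfolding Z(1) by blast+
  obtain \<alpha> \<beta> \<gamma> \<delta> where q: "\<qq> = \<alpha> *\<^sub>R a + \<beta> *\<^sub>R b + \<gamma> *\<^sub>R c + \<delta> *\<^sub>R d"
    using qF by (auto simp: span_insert span_singleton algebra_simps)
  \<comment> \<open>No plane lies in the orthogonal complement of \<open>\<qq>\<close>: it contains the lift of \<open>x' n\<close>.\<close>
  have nq: "B \<qq> s \<noteq> 0 \<or> B \<qq> t \<noteq> 0" if "P' n = span {s, t}" "x' n \<in> aff" for n s t
  proof (rule ccontr)
    assume "\<not> ?thesis"
    then have st: "B \<qq> s = 0" "B \<qq> t = 0" by auto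
    have "lift (x' n) \<in> span {s, t}" unfolding that(1)[symmetric] P'_def by (simp add: span_base)
    then obtain \<mu> \<nu> where "lift (x' n) = \<mu> *\<^sub>R s + \<nu> *\<^sub>R t"
      by (auto simp: span_insert span_singleton algebra_simps)
    then have "B \<qq> (lift (x' n)) = 0" by (simp add: B_simps st)
    then show False using lift_products(1)[OF that(2)] by simp
  qed
  note cyc = null_cycle[OF q null nq[OF spans(2) vert(6)] nq[OF spans(3) vert(7)]
      nq[OF spans(4) vert(8)] nq[OF spans(1) vert(5)]]
  have qn: "B \<qq> a = -1" "B \<qq> b = -1" "B \<qq> c = -1" "B \<qq> d = -1"
    using a(2) b(2) c(2) d(2) cyc by blast+
  have cross: "crossing_dual (x i) (v i) (x' i) (x j) (v j) (x' j) (\<eta> j i) (h j i)"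
    "crossing_dual (x j) (v j) (x' j) (x k) (v k) (x' k) (\<eta> k j) (h k j)"
    "crossing_dual (x k) (v k) (x' k) (x l) (v l) (x' l) (\<eta> l k) (h l k)"
    "crossing_dual (x l) (v l) (x' l) (x i) (v i) (x' i) (\<eta> i l) (h i l)"
    using a(2) b(2) c(2) d(2) cyc by blast+
  obtain r1 s1 r1' s1' c1 where f1: "crossing_form (x i) (v i) (x j) (v j) r1 s1 (- r1') s1' c1 (\<eta> j i)"
    "crossing_form (x' i) (v i) (x' j) (v j) r1' s1' (- r1) s1 c1 (h j i)"
    using cross(1) unfolding crossing_dual_def by blast
  obtain r2 s2 r2' s2' c2 where f2: "crossing_form (x j) (v j) (x k) (v k) r2 s2 (- r2') s2' c2 (\<eta> k j)"
    "crossing_form (x' j) (v j) (x' k) (v k) r2' s2' (- r2) s2 c2 (h k j)"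
    using cross(2) unfolding crossing_dual_def by blast
  obtain r3 s3 r3' s3' c3 where f3: "crossing_form (x k) (v k) (x l) (v l) r3 s3 (- r3') s3' c3 (\<eta> l k)"
    "crossing_form (x' k) (v k) (x' l) (v l) r3' s3' (- r3) s3 c3 (h l k)"
    using cross(3) unfolding crossing_dual_def by blast
  obtain r4 s4 r4' s4' c4 where f4: "crossing_form (x l) (v l) (x i) (v i) r4 s4 (- r4') s4' c4 (\<eta> i l)"
    "crossing_form (x' l) (v l) (x' i) (v i) r4' s4' (- r4) s4 c4 (h i l)"
    using cross(4) unfolding crossing_dual_def by blast
  have meet: "P i \<inter> P j = span {lift (x i + r1 *\<^sub>R v i)}" "P j \<inter> P k = span {lift (x j + r2 *\<^sub>R v j)}"
    "P k \<inter> P l = span {lift (x k + r3 *\<^sub>R v k)}" "P l \<inter> P i = span {lift (x l + r4 *\<^sub>R v l)}"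
    using crossing_meet f1(1) f2(1) f3(1) f4(1) vert dim unfolding P_def crossing_form_def by metis+
  note ne = wedge_spaces_nonzero_adjacent[OF reg[unfolded meet]]
  have meet': "P' i \<inter> P' j = span {lift (x' i + r1' *\<^sub>R v i)}" "P' j \<inter> P' k = span {lift (x' j + r2' *\<^sub>R v j)}"
    "P' k \<inter> P' l = span {lift (x' k + r3' *\<^sub>R v k)}" "P' l \<inter> P' i = span {lift (x' l + r4' *\<^sub>R v l)}"
    using crossing_meet f1(2) f2(2) f3(2) f4(2) vert dim' unfolding P'_def crossing_form_def by metis+
  have pt: "B \<qq> (lift (x' i + r1' *\<^sub>R v i)) = -1" "B \<qq> (lift (x' j + r2' *\<^sub>R v j)) = -1"
    "B \<qq> (lift (x' k + r3' *\<^sub>R v k)) = -1" "B \<qq> (lift (x' l + r4' *\<^sub>R v l)) = -1"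
    using vert by (auto intro!: lift_products(1))
  have abcd: "a = lift (x' i + r1' *\<^sub>R v i)" "b = lift (x' j + r2' *\<^sub>R v j)"
    "c = lift (x' k + r3' *\<^sub>R v k)" "d = lift (x' l + r4' *\<^sub>R v l)"
    using span_normalised_unique a(1) b(1) c(1) d(1) meet' pt qn by metis+
  have ne': "lift (x j + r2 *\<^sub>R v j) \<noteq> lift (x i + r1 *\<^sub>R v i)" "lift (x i + r1 *\<^sub>R v i) \<noteq> lift (x l + r4 *\<^sub>R v l)"
    "lift (x k + r3 *\<^sub>R v k) \<noteq> lift (x j + r2 *\<^sub>R v j)"
    using ne by (metis singletonI span_base)+
  have "pairing E b d = 0"
    unfolding E_def abcd
    by (rule opposite_corner_pairing_of_dual[OF vert f1(1) f2(1) f3(1) f4(1) f1(2) f2(2) f3(2) f4(2) H ne'(1,2)])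
      (use cyc(6) abcd in simp)
  then have bd: "B Z b = B Z d" by (simp add: Z(1) pairing_simps qn)
  have H': "\<eta> k j + \<eta> l k + \<eta> i l + \<eta> j i = 0" using closed by (simp add: add_ac)
  \<comment> \<open>The same argument for the quadrilateral started one vertex later.\<close>
  have "pairing (h k j + h l k + h i l + h j i) c a = 0"
    unfolding abcd
    by (rule opposite_corner_pairing_of_dual[OF vert(2,3,4,1) vert(6,7,8,5) vert(10,11,12,9)
      f2(1) f3(1) f4(1) f1(1) f2(2) f3(2) f4(2) f1(2) H' ne'(3) ne'(1)])
      (use cyc(5) abcd sym in metis)
  then have "pairing E c a = 0" by (simp add: E_def add_ac)
  then have "B Z a = B Z c" by (simp add: Z(1) pairing_simps qn)
  then have "E = 0"
    unfolding Z(1) using null_cycle_radical[OF q null qn ZF Z(2) _ bd] by blast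
  then show False using E0 by blast
qed

end

section \<open>The dual Legendre map\<close>

lemma lattice_edge_sym: "lattice_edge S i j \<longleftrightarrow> lattice_edge S j i"
  by (auto simp: lattice_edge_def)

lemma quadrilateral_edges:
  assumes "quadrilateral S i j k l"
  shows "lattice_edge S i j" "lattice_edge S j k" "lattice_edge S k l" "lattice_edge S l i"
proof -
  obtain a b s t where S: "i \<in> S" "j \<in> S" "k \<in> S" "l \<in> S"
    and st: "s = 1 \<or> s = -1" "t = 1 \<or> t = -1" and
    e: "j = i + axis a s" "k = i + axis a s + axis b t" "l = i + axis b t"
    using assms unfolding quadrilateral_def by blast
  have n: "axis c (-1) = - (axis c 1 :: int^'a)" for c by (simp add: vec_eq_iff axis_def)
  have d: "j = i + axis a 1 \<or> i = j + axis a 1" "k = j + axis b 1 \<or> j = k + axis b 1"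
     "l = k + axis a 1 \<or> k = l + axis a 1" "i = l + axis b 1 \<or> l = i + axis b 1"
    using st by (auto simp: e n)
  show "lattice_edge S i j" "lattice_edge S j k" "lattice_edge S k l" "lattice_edge S l i"
    using S d unfolding lattice_edge_def by blast+
qed

text \<open>Choose a value on every edge traversed in a positive coordinate direction and its negative on
  the reversed edge; no edge is positive in both directions.\<close>
lemma choose_one_form:
  assumes ex: "\<And>i j. lattice_edge S i j \<Longrightarrow> \<exists>\<omega>. D i j \<omega>"
    and flip: "\<And>i j \<omega>. lattice_edge S i j \<Longrightarrow> D i j \<omega> \<Longrightarrow> D j i (- \<omega>)"
  obtains h where "one_form S h" "\<And>i j. lattice_edge S i j \<Longrightarrow> D i j (h j i)"
proof -
  define up where "up i j \<longleftrightarrow> (\<exists>a. j = i + axis a 1)" for i j :: "int^'a"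
  define h where "h j i = (if up i j then SOME \<omega>. D i j \<omega> else - (SOME \<omega>. D j i \<omega>))" for j i
  have total: "up i j \<or> up j i" if "lattice_edge S i j" for i j
    using that by (auto simp: lattice_edge_def up_def)
  have excl: "\<not> up j i" if ij: "up i j" for i j
  proof
    assume "up j i"
    then obtain a b where ab: "j = i + axis a 1" "i = j + axis b 1" using ij unfolding up_def by blast
    have "i + (axis a 1 + axis b 1) = i" using ab(2) unfolding ab(1) by (simp add: add.assoc)
    then have "axis a 1 + axis b 1 = (0 :: int^'a)" by simp
    from arg_cong[OF this, of "\<lambda>u. u $ a"] show False by (simp add: axis_def split: if_splits)
  qed
  have "one_form S h"
    unfolding one_form_def h_def using total excl by auto
  moreover have "D i j (h j i)" if e: "lattice_edge S i j" for i j
  proof (cases "up i j")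
    case True
    then show ?thesis using someI_ex[OF ex[OF e]] by (simp add: h_def)
  next
    case False
    have e': "lattice_edge S j i" using e lattice_edge_sym by blast
    show ?thesis using flip[OF e' someI_ex[OF ex[OF e']]] False by (simp add: h_def)
  qed
  ultimately show thesis by (rule that)
qed

text \<open>Pairing with the members of an orthogonal basis recovers the coefficients up to sign.\<close>
lemma has_signature_nondegenerate:
  assumes sig: "has_signature B r s" and z: "\<And>z. B y z = 0"
  shows "y = 0"
proof -
  have B: "bilinear B" using sig by (simp add: has_signature_def)
  obtain P M where span: "span (P \<union> M) = UNIV" and ind: "independent (P \<union> M)"
    and orth: "\<forall>u\<in>P \<union> M. \<forall>v\<in>P \<union> M. u \<noteq> v \<longrightarrow> B u v = 0"
    and diag: "\<forall>u\<in>P. B u u = 1" "\<forall>u\<in>M. B u u = -1"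
    using sig unfolding has_signature_def by blast
  have fin: "finite (P \<union> M)" using ind by (rule independent_imp_finite)
  have "y \<in> span (P \<union> M)" using span by simp
  then obtain c where y: "y = (\<Sum>u\<in>P \<union> M. c u *\<^sub>R u)" unfolding span_finite[OF fin] by auto
  have "c u = 0" if u: "u \<in> P \<union> M" for u
  proof -
    have lin: "linear (\<lambda>y. B y u)" using B by (simp add: bilinear_def)
    have "0 = B y u" using z by simp
    also have "\<dots> = (\<Sum>w\<in>P \<union> M. c w * B w u)"
      unfolding y by (simp add: linear_sum[OF lin] linear_scale[OF lin])
    also have "\<dots> = (\<Sum>w\<in>P \<union> M. if w = u then c u * B u u else 0)"
      using orth u by (intro sum.cong) auto
    also have "\<dots> = c u * B u u" using fin u by simp
    finally show ?thesis using diag u by auto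
  qed
  then show ?thesis unfolding y by simp
qed

theorem theorem5p2:
  fixes p q :: nat
    and B :: "real^'n \<Rightarrow> real^'n \<Rightarrow> real"
    and \<oo> \<qq> :: "real^'n"
    and S :: "(int^'m) set"
    and f :: "int^'m \<Rightarrow> (real^'n) set"
    and \<eta> :: "int^'m \<Rightarrow> int^'m \<Rightarrow> real^'n^'n"
    and L L' :: "int^'m \<Rightarrow> (real^'n) set"
    and x' :: "int^'m \<Rightarrow> real^'n"
  assumes "p \<ge> 1" and "q \<ge> 1"
    and "has_signature B (p + 1) (q + 1)"
    and "\<oo> \<in> light_cone B" and "\<qq> \<in> light_cone B" and "B \<oo> \<qq> = -1"
    and "lattice_simply_connected S"
    and "applicable_with B S f \<eta>"
    and "stereoprojection B \<oo> \<qq> S f L"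
    and "\<forall>i\<in>S. x' i \<in> affine_part B \<oo> \<qq>"
    and "\<forall>i j. lattice_edge S i j \<longrightarrow>
           ddiff x' j i = affine_proj B \<oo> \<qq> (biv_act B (\<eta> j i) \<qq>)"
    and "\<forall>i\<in>S. x' i \<in> L' i \<and> affine_parallel (L i) (L' i)"
    and regularity: "\<forall>g. legendre_map B S g \<and> stereoprojection B \<oo> \<qq> S g L' \<longrightarrow> regular_map S g"
  shows "\<exists>g. applicable B S g \<and> stereoprojection B \<oo> \<qq> S g L'"
proof -
  have bil: "bilinear B" and sym: "\<And>y z. B y z = B z y"
    using assms(3) by (auto simp: has_signature_def)
  interpret stereo_frame B \<oo> \<qq>
    using bil sym has_signature_nondegenerate[OF assms(3)] assms(4-6)
    by unfold_locales (auto simp: light_cone_def)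
  have "\<forall>i\<in>S. \<exists>y w. y \<in> aff \<and> null_dir w \<and> L i = {y + r *\<^sub>R w | r. r \<in> UNIV}"
    using assms(9) unfolding stereoprojection_def affine_null_lines_def by blast
  from bchoice[OF this] obtain x where
    "\<forall>i\<in>S. \<exists>w. x i \<in> aff \<and> null_dir w \<and> L i = {x i + r *\<^sub>R w | r. r \<in> UNIV}" by (rule exE)
  from bchoice[OF this] obtain v where
    line: "\<forall>i\<in>S. x i \<in> aff \<and> null_dir (v i) \<and> L i = {x i + r *\<^sub>R v i | r. r \<in> UNIV}" by (rule exE)
  have xv: "\<And>i. i \<in> S \<Longrightarrow> x i \<in> aff" "\<And>i. i \<in> S \<Longrightarrow> null_dir (v i)"
    and L: "\<And>i. i \<in> S \<Longrightarrow> L i = {x i + r *\<^sub>R v i | r. r \<in> UNIV}"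
    using line by blast+
  have x': "\<And>i. i \<in> S \<Longrightarrow> x' i \<in> aff" using assms(10) by blast
  have f: "f i = plane (x i) (v i)" if "i \<in> S" for i
  proof -
    have "f i = line_to_plane B \<oo> \<qq> (L i)" using assms(9) that by (simp add: stereoprojection_def)
    moreover have "B (v i) (v i) = 0" using xv(2)[OF that] by blast
    ultimately show ?thesis unfolding L[OF that] by (simp only: line_to_plane_eq_plane)
  qed
  have L': "L' i = {x' i + r *\<^sub>R v i | r. r \<in> UNIV}" if i: "i \<in> S" for i
  proof -
    obtain t where t: "L' i = (\<lambda>y. t + y) ` L i"
      using assms(12) i unfolding affine_parallel_def by blast
    have "x' i \<in> L' i" using assms(12) i by blast
    then obtain r0 where r0: "x' i = t + (x i + r0 *\<^sub>R v i)" unfolding t L[OF i] by blast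
    have "t + (x i + r *\<^sub>R v i) = x' i + (r - r0) *\<^sub>R v i" "x' i + r *\<^sub>R v i = t + (x i + (r0 + r) *\<^sub>R v i)" for r
      by (simp_all add: r0 algebra_simps)
    then show ?thesis unfolding t L[OF i] by blast
  qed
  define g where "g = (\<lambda>i. plane (x' i) (v i))"
  have edgeS: "i \<in> S" "j \<in> S" if "lattice_edge S i j" for i j
    using that by (auto simp: lattice_edge_def)
  define D where "D i j = dual_edge (x i) (v i) (x' i) (x j) (v j) (x' j) (\<eta> j i)" for i j
  have app: "one_form S \<eta>" "closed_form S \<eta>" "regular_map S f" "legendre_map B S f"
    using assms(8) by (auto simp: applicable_with_def)
  have fdim: "dim (sum_space (f i) (f j)) = 3" if "lattice_edge S i j" for i j
    using app(3) that by (simp add: regular_map_def)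
  have D_ex: "\<exists>\<omega>. D i j \<omega>" if e: "lattice_edge S i j" for i j
  proof -
    have "lattice_edge S j i" using e lattice_edge_sym by blast
    then have "\<eta> j i \<in> ext_square (sum_space (f j) (f i))" "biv_wedge_space (\<eta> j i) (f j \<inter> f i) \<noteq> {0}"
      using assms(8) unfolding applicable_with_def by blast+
    then have w: "\<eta> j i \<in> ext_square (sum_space (f i) (f j))" "biv_wedge_space (\<eta> j i) (f i \<inter> f j) \<noteq> {0}"
      by (simp_all add: sum_space_commute[of "f j" "f i"] Int_commute[of "f j" "f i"])
    have m: "f i \<inter> f j \<noteq> {0}" using app(4) e by (simp add: legendre_map_def)
    have dx: "x' j - x' i = affine_proj B \<oo> \<qq> (biv_act B (\<eta> j i) \<qq>)"
      using assms(11) e by (simp add: ddiff_def)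
    show ?thesis unfolding D_def
      by (rule dual_edge_exists)
        (use m fdim[OF e] w dx f edgeS[OF e] xv in simp_all)
  qed
  have D_flip: "D j i (- \<omega>)" if e: "lattice_edge S i j" and D: "D i j \<omega>" for i j \<omega>
  proof -
    have "\<eta> j i = - \<eta> i j" using app(1) e by (simp add: one_form_def)
    then show ?thesis using dual_edge_flip[OF D[unfolded D_def]] xv(2) edgeS[OF e] by (simp add: D_def)
  qed
  obtain h where h: "one_form S h" and hD: "\<And>i j. lattice_edge S i j \<Longrightarrow> D i j (h j i)"
    using choose_one_form[of S D] D_ex D_flip by blast
  have leg: "legendre_map B S g"
    unfolding legendre_map_def null_planes_def
  proof (intro conjI ballI allI impI CollectI)
    fix i assume i: "i \<in> S"
    show "subspace (g i)" by (simp add: g_def)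
    show "dim (g i) = 2" unfolding g_def by (rule dim_plane[OF x'[OF i] xv(2)[OF i]])
    show "B y z = 0" if "y \<in> g i" "z \<in> g i" for y z
      using plane_null[OF x'[OF i] xv(2)[OF i]] that by (simp add: g_def)
  next
    fix i j assume e: "lattice_edge S i j"
    show "g i \<inter> g j \<noteq> {0}"
      unfolding g_def using dual_edge_planes_meet[OF hD[OF e, unfolded D_def]] xv x' edgeS[OF e] by blast
  qed
  have stereo: "stereoprojection B \<oo> \<qq> S g L'"
    unfolding stereoprojection_def
  proof (intro ballI conjI)
    fix i assume i: "i \<in> S"
    have "lift (x' i) \<in> g i" by (simp add: g_def span_base)
    then show "\<not> g i \<subseteq> {z. B \<qq> z = 0}" using lift_products(1)[OF x'[OF i]] by fastforce
    show "L' i \<in> affine_null_lines B \<oo> \<qq>"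
      unfolding affine_null_lines_def using L'[OF i] x'[OF i] xv(2)[OF i] by blast
    show "g i = line_to_plane B \<oo> \<qq> (L' i)"
      unfolding L'[OF i] g_def using xv(2)[OF i] by (simp only: line_to_plane_eq_plane)
  qed
  have reg: "regular_map S g" using regularity leg stereo by blast
  have gdim: "dim (sum_space (g i) (g j)) = 3" if "lattice_edge S i j" for i j
    using reg that by (simp add: regular_map_def)
  have hedge: "h i j \<in> ext_square (sum_space (g i) (g j)) \<and> biv_wedge_space (h i j) (g i \<inter> g j) \<noteq> {0}"
    if e: "lattice_edge S i j" for i j
  proof -
    have e': "lattice_edge S j i" using e lattice_edge_sym by blast
    have d: "dim (sum_space (plane (x' j) (v j)) (plane (x' i) (v i))) = 3"
      using gdim[OF e'] by (simp add: g_def)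
    show ?thesis
      using dual_edge_applicable[OF hD[OF e', unfolded D_def] xv(2) xv(2) d] edgeS[OF e]
      by (simp add: g_def sum_space_commute[of "plane (x' i) (v i)"] Int_commute)
  qed
  have "closed_form S h"
    unfolding closed_form_def
  proof (intro allI impI)
    fix i j k l assume Q: "quadrilateral S i j k l"
    note e = quadrilateral_edges[OF Q]
    have ijkl: "i \<in> S" "j \<in> S" "k \<in> S" "l \<in> S" using Q by (auto simp: quadrilateral_def)
    have fp: "plane (x i) (v i) = f i" "plane (x j) (v j) = f j"
        "plane (x k) (v k) = f k" "plane (x l) (v l) = f l"
      using f ijkl by blast+
    show "h i l + h l k + h k j + h j i = 0"
    proof (rule dual_closed_on_quad[of x i j k l x' v \<eta> h])
      show "\<eta> i l + \<eta> l k + \<eta> k j + \<eta> j i = 0" using app(2) Q by (simp add: closed_form_def)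
    qed (use ijkl xv x' hD e fdim gdim app(3) reg Q in \<open>simp_all add: D_def g_def regular_map_def fp\<close>)
  qed
  then have "applicable_with B S g h"
    unfolding applicable_with_def using leg reg h hedge by blast
  then show ?thesis using stereo unfolding applicable_def by blast
qed

end
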